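(* Let $d\ge 4$, $0<p<1$, $b>0$. There exists a constant $\alpha_0=\alpha_0(p)>p$ such that $$\lambda(\alpha)=\phi(\alpha)\qquad\text{for all } 0\le\alpha<\alpha_0 .$$ In particular $M(p)\ge\alpha_0$, and the almost sure constant limit $\lambda(\alpha)=\lim_{t\to\infty}[N_t(\alpha)]^{1/t}$ exists for all $0\le\alpha<\alpha_0$.
   Context: $\mathcal L$ is the directed graph with vertex set $\mathbb Z^d\times\mathbb Z_+$ ($\mathbb Z_+=\{0,1,2,\dots\}$) in which each vertex $v$ has exactly $2d$ outgoing edges, namely to $v\pm e_i+e_{d+1}$ for $1\le i\le d$, where $e_i$ is the $i$-th coordinate vector. $\mathbf 0$ denotes the origin. An oriented path of length $s$ is a sequence $\pi=(\pi_0,\pi_1,\dots,\pi_s)$ of vertices such that there is a directed edge of $\mathcal L$ from $\pi_{i}$ to $\pi_{i+1}$ for $0\le i<s$; we write $|\pi|=s$. The random variables $\{X(v): v\in\mathbb Z^d\times\mathbb Z_+\}$ are i.i.d. with $P\{X(v)=e^b\}=p$, $P\{X(v)=1\}=1-p$. For a path $\pi$ of length $s$, $W(\pi)$ is the number of indices $i$ with $1\le i\le s$ and $X(\pi_i)=e^b$ (the starting vertex $\pi_0$ is not counted). For real $\alpha\ge0$, $N_s(\alpha)$ is the number of oriented paths $\pi$ of length $s$ with $\pi_0=\mathbf 0$ and $W(\pi)\ge\alpha s$. $M(p):=\lim_{s\to\infty}\max_{\pi_0=\mathbf 0,|\pi|=s}\frac1s W(\pi)$, the maximum being over oriented paths of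 length $s$ starting at $\mathbf 0$; this limit exists almost surely and is almost surely a constant. $\lambda(\alpha)=\lambda(\alpha,p)$ denotes the almost sure constant value of $\lim_{t\to\infty}[N_t(\alpha)]^{1/t}$; it exists whenever $\alpha\ge0$, $\alpha\ne M(p)$, and an assertion $\lambda(\alpha)=c$ means that this limit exists almost surely and equals $c$. Further, $\phi(\alpha):=\lim_{n\to\infty}[E N_n(\alpha)]^{1/n}$. *)

theory Defs
  imports "HOL-Probability.Probability"
begin

text \<open>
  The dimension $d$ is \<^term>\<open>CARD('d)\<close>. A vertex of $Z^d \times Z_+$ is a pair of a spatial
  position and a level.
\<close>

type_synonym 'd vertex = "(int ^ 'd) \<times> nat"

definition edge :: "'d::finite vertex \<Rightarrow> 'd vertex \<Rightarrow> bool" where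
  "edge u v \<longleftrightarrow>
     (\<exists>i. fst v = fst u + axis i 1 \<or> fst v = fst u - axis i 1) \<and> snd v = snd u + 1"

definition origin :: "'d::finite vertex" where
  "origin = (0, 0)"

text \<open>A path of length $s$ is the list of its $s + 1$ vertices.\<close>

definition paths :: "'d::finite vertex \<Rightarrow> nat \<Rightarrow> 'd vertex list set" where
  "paths v s =
     {\<pi>. length \<pi> = s + 1 \<and> \<pi> ! 0 = v \<and> (\<forall>i<s. edge (\<pi> ! i) (\<pi> ! (i + 1)))}"

locale iid_environment = prob_space M for M :: "'w measure" +
  fixes X :: "'d::finite vertex \<Rightarrow> 'w \<Rightarrow> real" and b p :: real
  assumes indep: "indep_vars (\<lambda>_. borel) X UNIV"
    and prob_high: "\<And>v. prob {\<omega> \<in> space M. X v \<omega> = exp b} = p"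
    and prob_low: "\<And>v. prob {\<omega> \<in> space M. X v \<omega> = 1} = 1 - p"

text \<open>
  In the definitions below, \<^term>\<open>x :: 'd::finite vertex \<Rightarrow> real\<close> is a single realization
  of the environment. The starting vertex of a path does not contribute to its weight.
\<close>

definition weight :: "real \<Rightarrow> ('d::finite vertex \<Rightarrow> real) \<Rightarrow> 'd vertex list \<Rightarrow> nat" where
  "weight b x \<pi> = card {i. 1 \<le> i \<and> i < length \<pi> \<and> x (\<pi> ! i) = exp b}"

definition num_paths :: "real \<Rightarrow> ('d::finite vertex \<Rightarrow> real) \<Rightarrow> real \<Rightarrow> nat \<Rightarrow> nat" where
  "num_paths b x \<alpha> s = card {\<pi> \<in> paths origin s. real (weight b x \<pi>) \<ge> \<alpha> * real s}"

definition max_density :: "real \<Rightarrow> ('d::finite vertex \<Rightarrow> real) \<Rightarrow> nat \<Rightarrow> real" where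
  "max_density b x s = Max ((\<lambda>\<pi>. real (weight b x \<pi>) / real s) ` paths origin s)"

text \<open>The assertion $M(p) = m$, including the almost sure existence of the limit.\<close>

definition M_eq ::
  "'w measure \<Rightarrow> ('d::finite vertex \<Rightarrow> 'w \<Rightarrow> real) \<Rightarrow> real \<Rightarrow> real \<Rightarrow> bool" where
  "M_eq M X b m \<longleftrightarrow> (AE \<omega> in M. (\<lambda>s. max_density b (\<lambda>v. X v \<omega>) s) \<longlonglongrightarrow> m)"

text \<open>The assertion $\lambda(\alpha) = c$, including the almost sure existence of the limit.\<close>

definition lambda_eq ::
  "'w measure \<Rightarrow> ('d::finite vertex \<Rightarrow> 'w \<Rightarrow> real) \<Rightarrow> real \<Rightarrow> real \<Rightarrow> real \<Rightarrow> bool" where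
  "lambda_eq M X b \<alpha> c \<longleftrightarrow>
     (AE \<omega> in M. (\<lambda>t. real (num_paths b (\<lambda>v. X v \<omega>) \<alpha> t) powr (1 / real t)) \<longlonglongrightarrow> c)"

definition mean_growth ::
  "'w measure \<Rightarrow> ('d::finite vertex \<Rightarrow> 'w \<Rightarrow> real) \<Rightarrow> real \<Rightarrow> real \<Rightarrow> nat \<Rightarrow> real" where
  "mean_growth M X b \<alpha> n =
     (\<integral>\<omega>. real (num_paths b (\<lambda>v. X v \<omega>) \<alpha> n) \<partial>M) powr (1 / real n)"

definition phi ::
  "'w measure \<Rightarrow> ('d::finite vertex \<Rightarrow> 'w \<Rightarrow> real) \<Rightarrow> real \<Rightarrow> real \<Rightarrow> real" where
  "phi M X b \<alpha> = lim (mean_growth M X b \<alpha>)"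

end

theory Submission
  imports Defs
begin

text \<open>
  Give every path weight $e^{\beta W(\pi)}$ and let $Z_n(\beta)$ be the sum of these weights over the
  paths of length $n$ from the origin. Since a path visits $n$ distinct sites,
  $E Z_n(\beta) = (2d\,m(\beta))^n$ with $m(\beta) = 1 - p + p e^\beta$. The heart of the proof is that
  for small $\beta \ge 0$ the random quantity $\frac1n \ln Z_n(\beta)$ has almost surely the same limit
  $\Lambda(\beta) = \ln (2d\,m(\beta))$ as its annealed counterpart. Both $N_n(\alpha)$ and
  $E N_n(\alpha)$ are tails of a measure on the possible values of $W$ whose exponential moments grow
  like $e^{n\Lambda(\beta)}$, and a Gaertner-Ellis argument that only looks at exponential moments yields
  for both the growth rate $\exp(\Lambda(\beta) - \beta\Lambda'(\beta))$, where
  $\Lambda'(\beta) = \alpha$ if $\alpha \ge p$, and $\beta = 0$ if $\alpha \le p$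
  (\<open>exponential_weights.tail_growth\<close>). As $\Lambda'(0) = p$ and $\Lambda'$ is strictly increasing,
  $\alpha_0 = \Lambda'(\beta_1) > p$ works as soon as the equality of limits is known on $[0, \beta_1)$.
  
  To compare $Z_n$ with its mean, write $E Z_n^2 / (E Z_n)^2$ as the expectation of $r^L$, where $L$ counts
  the meetings of two independent walks and $r = m(2\beta)/m(\beta)^2$ tends to $1$ as
  $\beta \to 0$. The difference of the walks is transient; a quantitative form of this that suffices
  is that $x \mapsto 1/(|x|^2 + 2)$ is strictly superharmonic for simple random walk on $Z^d$, $d \ge 4$.
  Adding $1$ to this function gives a bounded supersolution for the walk that is rewarded by a factor
  slightly above $1$ at each visit to $0$ (\<open>supersolution_with_contact_reward\<close>), so the second moment is
  at most twice the squared mean. By the Paley-Zygmund inequality, $Z_n \ge \frac12 E Z_n$ has probability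
  at least $1/8$.
  
  A path meets each level once, so changing the environment on one level changes $\ln Z_n$ by at most
  $\beta$. The method of bounded differences, applied to the independent levels, makes
  $\ln Z_n$ concentrate around its mean on the scale $\sqrt n$. Together with the constant probability just
  obtained, this forces $E \ln Z_n \ge n\Lambda(\beta) - O(\sqrt n)$, while Jensen's inequality gives the
  reverse bound; concentration once more and Borel-Cantelli turn it into an almost sure limit.
  
  The same concentration handles the maximal weight $\max_\pi W(\pi)$, which changes by at most $1$ per level.
  Its mean is superadditive, so $M(p)$ exists by Fekete's lemma; and $M(p) \ge \alpha$ for every
  $\alpha < \alpha_0$, because $N_n(\alpha)$ grows and hence is eventually positive.
  
  Only finitely many sites matter for paths of length $n$. All moments are therefore computed on finite
  product spaces of Bernoulli variables, and only the final statements are transferred to the given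
  probability space.
\<close>

section \<open>Bernoulli fields on finite sets\<close>

definition bernoulli_field :: "real \<Rightarrow> 'a set \<Rightarrow> ('a \<Rightarrow> bool) pmf" where
  "bernoulli_field p A = Pi_pmf A False (\<lambda>_. bernoulli_pmf p)"

abbreviation bexp :: "real \<Rightarrow> 'a set \<Rightarrow> (('a \<Rightarrow> bool) \<Rightarrow> real) \<Rightarrow> real" where
  "bexp p A F \<equiv> measure_pmf.expectation (bernoulli_field p A) F"

definition depends_on :: "'a set \<Rightarrow> (('a \<Rightarrow> bool) \<Rightarrow> 'b) \<Rightarrow> bool" where
  "depends_on B F \<longleftrightarrow> (\<forall>\<eta> \<eta>'. (\<forall>v\<in>B. \<eta> v = \<eta>' v) \<longrightarrow> F \<eta> = F \<eta>')"

definition merge :: "'a set \<Rightarrow> ('a \<Rightarrow> bool) \<Rightarrow> ('a \<Rightarrow> bool) \<Rightarrow> 'a \<Rightarrow> bool" where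
  "merge B \<eta> \<zeta> = (\<lambda>v. if v \<in> B then \<eta> v else \<zeta> v)"

lemma depends_onD: "depends_on B F \<Longrightarrow> (\<And>v. v \<in> B \<Longrightarrow> \<eta> v = \<eta>' v) \<Longrightarrow> F \<eta> = F \<eta>'"
  unfolding depends_on_def by blast

lemma finite_set_bernoulli_field: "finite A \<Longrightarrow> finite (set_pmf (bernoulli_field p A))"
  unfolding bernoulli_field_def
  by (rule finite_subset[OF set_Pi_pmf_subset']) (auto intro!: finite_PiE_dflt)

lemma bernoulli_field_outside: "finite A \<Longrightarrow> \<eta> \<in> set_pmf (bernoulli_field p A) \<Longrightarrow> v \<notin> A \<Longrightarrow> \<not> \<eta> v"
  using set_Pi_pmf_subset[of A False "\<lambda>_. bernoulli_pmf p"] by (auto simp: bernoulli_field_def)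

lemma bexp_integrable [simp]:
  fixes F :: "('a \<Rightarrow> bool) \<Rightarrow> real"
  shows "finite A \<Longrightarrow> integrable (measure_pmf (bernoulli_field p A)) F"
  by (intro integrable_measure_pmf_finite finite_set_bernoulli_field)

lemma pmf_expectation_cong:
  fixes F G :: "'a \<Rightarrow> real"
  assumes "\<And>x. x \<in> set_pmf P \<Longrightarrow> F x = G x"
  shows "measure_pmf.expectation P F = measure_pmf.expectation P G"
  by (rule integral_cong_AE) (auto simp: AE_measure_pmf_iff assms)

lemma pmf_expectation_mono:
  fixes F G :: "'a \<Rightarrow> real"
  assumes "finite (set_pmf P)" "\<And>x. x \<in> set_pmf P \<Longrightarrow> F x \<le> G x"
  shows "measure_pmf.expectation P F \<le> measure_pmf.expectation P G"
  by (rule integral_mono_AE)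
     (auto simp: AE_measure_pmf_iff assms intro!: integrable_measure_pmf_finite)

lemma pair_pmf_expectation:
  fixes F :: "'a \<times> 'b \<Rightarrow> real"
  assumes P: "finite (set_pmf P)" and Q: "finite (set_pmf Q)"
  shows "measure_pmf.expectation (pair_pmf P Q) F =
         measure_pmf.expectation P (\<lambda>x. measure_pmf.expectation Q (\<lambda>y. F (x, y)))"
proof -
  have "measure_pmf.expectation (pair_pmf P Q) F =
        (\<Sum>z\<in>set_pmf P \<times> set_pmf Q. F z * pmf (pair_pmf P Q) z)"
    by (rule integral_measure_pmf_real) (use P Q in auto)
  also have "\<dots> = (\<Sum>x\<in>set_pmf P. \<Sum>y\<in>set_pmf Q. F (x, y) * (pmf P x * pmf Q y))"
    by (simp add: sum.cartesian_product case_prod_unfold flip: pmf_pair)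
  also have "\<dots> = (\<Sum>x\<in>set_pmf P. (\<Sum>y\<in>set_pmf Q. F (x, y) * pmf Q y) * pmf P x)"
    unfolding sum_distrib_right by (intro sum.cong refl) (simp add: mult_ac)
  also have "\<dots> = (\<Sum>x\<in>set_pmf P. measure_pmf.expectation Q (\<lambda>y. F (x, y)) * pmf P x)"
    by (intro sum.cong refl, subst integral_measure_pmf_real[OF Q]) auto
  also have "\<dots> = measure_pmf.expectation P (\<lambda>x. measure_pmf.expectation Q (\<lambda>y. F (x, y)))"
    by (rule integral_measure_pmf_real[symmetric]) (use P in auto)
  finally show ?thesis .
qed

lemma bexp_union:
  assumes "finite A" "finite B" "A \<inter> B = {}"
  shows "bexp p (A \<union> B) F = bexp p A (\<lambda>\<eta>. bexp p B (\<lambda>\<zeta>. F (merge A \<eta> \<zeta>)))"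
proof -
  have "bexp p (A \<union> B) F = measure_pmf.expectation (pair_pmf (bernoulli_field p A) (bernoulli_field p B))
      (\<lambda>z. F (merge A (fst z) (snd z)))"
    unfolding bernoulli_field_def
    by (subst Pi_pmf_union[OF assms]) (simp add: merge_def case_prod_unfold)
  also have "\<dots> = bexp p A (\<lambda>\<eta>. bexp p B (\<lambda>\<zeta>. F (merge A \<eta> \<zeta>)))"
    by (subst pair_pmf_expectation) (simp_all add: finite_set_bernoulli_field assms)
  finally show ?thesis .
qed

text \<open>
  Outside $A$ the field is constantly \<^const>\<open>False\<close>, so $B$ and $C$ may be arbitrary
  disjoint sets: only their intersections with $A$ are random.
\<close>

lemma bexp_mult:
  assumes A: "finite A" and F: "depends_on B F" and G: "depends_on C G" and BC: "B \<inter> C = {}"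
  shows "bexp p A (\<lambda>\<eta>. F \<eta> * G \<eta>) = bexp p A F * bexp p A G"
proof -
  have fin: "finite (A \<inter> B)" "finite (A - B)" using A by auto
  have split: "bexp p A H = bexp p (A \<inter> B) (\<lambda>\<eta>. bexp p (A - B) (\<lambda>\<zeta>. H (merge (A \<inter> B) \<eta> \<zeta>)))" for H
    using bexp_union[of "A \<inter> B" "A - B" p H] fin by (simp add: Int_Diff_Un Int_Diff_disjoint)
  have 1: "F (merge (A \<inter> B) \<eta> \<zeta>) = F \<eta>"
    if "\<eta> \<in> set_pmf (bernoulli_field p (A \<inter> B))" "\<zeta> \<in> set_pmf (bernoulli_field p (A - B))" for \<eta> \<zeta>
    using bernoulli_field_outside[OF fin(1) that(1)] bernoulli_field_outside[OF fin(2) that(2)]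
    by (intro depends_onD[OF F]) (auto simp: merge_def)
  have 2: "G (merge (A \<inter> B) \<eta> \<zeta>) = G \<zeta>" for \<eta> \<zeta>
    using BC by (intro depends_onD[OF G]) (auto simp: merge_def)
  have FG: "bexp p A (\<lambda>\<eta>. F \<eta> * H \<eta>) = bexp p (A \<inter> B) F * bexp p (A - B) H"
    if H: "\<And>\<eta> \<zeta>. H (merge (A \<inter> B) \<eta> \<zeta>) = H \<zeta>" for H
  proof -
    have "bexp p A (\<lambda>\<eta>. F \<eta> * H \<eta>) =
        bexp p (A \<inter> B) (\<lambda>\<eta>. bexp p (A - B) (\<lambda>\<zeta>. F \<eta> * H \<zeta>))"
      unfolding split[of "\<lambda>\<eta>. F \<eta> * H \<eta>"] by (intro pmf_expectation_cong) (simp add: 1 H)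
    then show ?thesis by simp
  qed
  have "bexp p A F = bexp p (A \<inter> B) F" using FG[of "\<lambda>_. 1"] by simp
  moreover have "bexp p A G = bexp p (A - B) G" unfolding split[of G] by (simp add: 2)
  ultimately show ?thesis using FG[of G, OF 2] by simp
qed

lemma bexp_single:
  assumes A: "finite A" "v \<in> A" and p: "0 \<le> p" "p \<le> 1"
  shows "bexp p A (\<lambda>\<eta>. g (\<eta> v)) = p * g True + (1 - p) * g False"
proof -
  have "bexp p A (\<lambda>\<eta>. g (\<eta> v)) =
      measure_pmf.expectation (map_pmf (\<lambda>\<eta>. \<eta> v) (bernoulli_field p A)) g" by simp
  also have "\<dots> = measure_pmf.expectation (bernoulli_pmf p) g"
    unfolding bernoulli_field_def by (subst Pi_pmf_component) (use A in auto)
  finally show ?thesis using p by (simp add: mult.commute)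
qed

lemma bexp_subset:
  assumes A: "finite A" "B \<subseteq> A" and F: "depends_on B F"
  shows "bexp p A F = bexp p B F"
proof -
  have "bexp p B F = bexp p A (\<lambda>\<eta>. F (\<lambda>x. if x \<in> B then \<eta> x else False))"
    unfolding bernoulli_field_def by (subst Pi_pmf_subset[OF A]) simp
  also have "\<dots> = bexp p A F"
    by (intro pmf_expectation_cong depends_onD[OF F]) auto
  finally show ?thesis by simp
qed

section \<open>Concentration under bounded differences\<close>

lemma pmf_Hoeffding:
  fixes f :: "'a \<Rightarrow> real"
  assumes fin: "finite (set_pmf P)" and t: "t > 0"
    and osc: "\<And>x y. x \<in> set_pmf P \<Longrightarrow> y \<in> set_pmf P \<Longrightarrow> f x \<le> f y + c"
  shows "measure_pmf.expectation P (\<lambda>x. exp (t * (f x - measure_pmf.expectation P f)))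
         \<le> exp (t\<^sup>2 * c\<^sup>2 / 8)"
proof -
  define a where "a = Min (f ` set_pmf P)"
  have ne: "set_pmf P \<noteq> {}" by (rule set_pmf_not_empty)
  have "a \<in> f ` set_pmf P" unfolding a_def by (intro Min_in) (use fin ne in auto)
  then obtain y where y: "y \<in> set_pmf P" "a = f y" by blast
  have amin: "a \<le> f x" if "x \<in> set_pmf P" for x
    unfolding a_def by (intro Min_le) (use fin that in auto)
  interpret interval_bounded_random_variable "measure_pmf P" f a "a + c"
  proof
    show "AE x in measure_pmf P. f x \<in> {a..a + c}"
      unfolding AE_measure_pmf_iff using osc[OF _ y(1)] amin y(2) by auto
  qed auto
  have "ennreal (measure_pmf.expectation P (\<lambda>x. exp (t * (f x - measure_pmf.expectation P f)))) =
      nn_integral (measure_pmf P) (\<lambda>x. exp (t * (f x - measure_pmf.expectation P f)))"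
    by (intro nn_integral_eq_integral[symmetric] integrable_measure_pmf_finite fin) auto
  also have "\<dots> \<le> ennreal (exp (t\<^sup>2 * (a + c - a)\<^sup>2 / 8))"
    by (rule Hoeffdings_lemma_nn_integral[OF t])
  finally show ?thesis by simp
qed

text \<open>
  McDiarmid's martingale argument by induction on the number of levels: average out the top level,
  whose conditional fluctuation is controlled by Hoeffding's lemma. The averaged function
  still satisfies the bounded difference condition on the remaining levels.
\<close>

lemma bexp_exp_bounded_differences:
  fixes F :: "('a \<Rightarrow> bool) \<Rightarrow> real" and lev :: "'a \<Rightarrow> nat"
  assumes "finite A" and "lev ` A \<subseteq> {1..n}" and t: "t > 0"
    and "\<And>k \<eta> \<eta>'. (\<And>v. lev v \<noteq> k \<Longrightarrow> \<eta> v = \<eta>' v) \<Longrightarrow> F \<eta> \<le> F \<eta>' + c"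
  shows "bexp p A (\<lambda>\<eta>. exp (t * (F \<eta> - bexp p A F))) \<le> exp (real n * t\<^sup>2 * c\<^sup>2 / 8)"
  using assms(1,2,4)
proof (induction n arbitrary: A F)
  case 0
  then have "A = {}" by auto
  then show ?case by (simp add: bernoulli_field_def)
next
  case (Suc n)
  define B where "B = {v \<in> A. lev v \<le> n}"
  define C where "C = {v \<in> A. lev v = Suc n}"
  have A: "A = B \<union> C" using Suc.prems(2) by (auto simp: B_def C_def)
  have fin: "finite B" "finite C" and BC: "B \<inter> C = {}"
    using Suc.prems(1) by (auto simp: B_def C_def)
  define g where "g = (\<lambda>\<eta>. bexp p C (\<lambda>\<zeta>. F (merge B \<eta> \<zeta>)))"
  have Eg: "bexp p A F = bexp p B g"
    unfolding A g_def by (rule bexp_union[OF fin BC])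
  have inner: "bexp p C (\<lambda>\<zeta>. exp (t * (F (merge B \<eta> \<zeta>) - g \<eta>))) \<le> exp (t\<^sup>2 * c\<^sup>2 / 8)" for \<eta>
    unfolding g_def
  proof (rule pmf_Hoeffding[OF finite_set_bernoulli_field[OF fin(2)] t])
    fix x y assume xy: "x \<in> set_pmf (bernoulli_field p C)" "y \<in> set_pmf (bernoulli_field p C)"
    show "F (merge B \<eta> x) \<le> F (merge B \<eta> y) + c"
      using bernoulli_field_outside[OF fin(2) xy(1)] bernoulli_field_outside[OF fin(2) xy(2)]
      by (intro Suc.prems(3)[of "Suc n"]) (auto simp: merge_def C_def)
  qed
  have "bexp p A (\<lambda>\<eta>. exp (t * (F \<eta> - bexp p A F))) =
      bexp p B (\<lambda>\<eta>. exp (t * (g \<eta> - bexp p B g)) *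
        bexp p C (\<lambda>\<zeta>. exp (t * (F (merge B \<eta> \<zeta>) - g \<eta>))))"
    unfolding Eg unfolding A bexp_union[OF fin BC]
    by (subst integral_mult_right_zero[symmetric]) (simp add: algebra_simps flip: exp_add)
  also have "\<dots> \<le> bexp p B (\<lambda>\<eta>. exp (t * (g \<eta> - bexp p B g)) * exp (t\<^sup>2 * c\<^sup>2 / 8))"
    by (intro pmf_expectation_mono finite_set_bernoulli_field fin mult_left_mono inner) auto
  also have "\<dots> = bexp p B (\<lambda>\<eta>. exp (t * (g \<eta> - bexp p B g))) * exp (t\<^sup>2 * c\<^sup>2 / 8)" by simp
  also have "\<dots> \<le> exp (real n * t\<^sup>2 * c\<^sup>2 / 8) * exp (t\<^sup>2 * c\<^sup>2 / 8)"
  proof (intro mult_right_mono Suc.IH fin)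
    show "lev ` B \<subseteq> {1..n}" using Suc.prems(2) by (auto simp: B_def)
    fix k and \<eta> \<eta>' :: "'a \<Rightarrow> bool" assume *: "\<And>v. lev v \<noteq> k \<Longrightarrow> \<eta> v = \<eta>' v"
    have "g \<eta> \<le> bexp p C (\<lambda>\<zeta>. F (merge B \<eta>' \<zeta>) + c)"
      unfolding g_def
      by (intro pmf_expectation_mono finite_set_bernoulli_field fin Suc.prems(3)[of k])
         (use * in \<open>auto simp: merge_def\<close>)
    also have "\<dots> = g \<eta>' + c" unfolding g_def by (simp add: fin)
    finally show "g \<eta> \<le> g \<eta>' + c" .
  qed auto
  also have "\<dots> = exp (real (Suc n) * t\<^sup>2 * c\<^sup>2 / 8)"
    by (simp add: field_simps flip: exp_add)
  finally show ?case .
qed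

lemma bounded_differences_upper_tail:
  fixes F :: "('a \<Rightarrow> bool) \<Rightarrow> real" and lev :: "'a \<Rightarrow> nat"
  assumes A: "finite A" and lev: "lev ` A \<subseteq> {1..n}" and n: "n > 0" and c: "c > 0" and s: "s > 0"
    and diff: "\<And>k \<eta> \<eta>'. (\<And>v. lev v \<noteq> k \<Longrightarrow> \<eta> v = \<eta>' v) \<Longrightarrow> F \<eta> \<le> F \<eta>' + c"
  shows "measure_pmf.prob (bernoulli_field p A) {\<eta>. F \<eta> \<ge> bexp p A F + s} \<le> exp (- 2 * s\<^sup>2 / (n * c\<^sup>2))"
proof -
  \<comment> \<open>The value of $t$ that minimises the Chernoff bound $\exp(- t s + n t^2 c^2 / 8)$.\<close>
  define t where "t = 4 * s / (n * c\<^sup>2)"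
  have t: "t > 0" using n c s by (simp add: t_def)
  have "measure_pmf.prob (bernoulli_field p A) {\<eta>. F \<eta> \<ge> bexp p A F + s} =
      bexp p A (indicator {\<eta>. F \<eta> \<ge> bexp p A F + s})" by simp
  also have "\<dots> \<le> bexp p A (\<lambda>\<eta>. exp (- t * s) * exp (t * (F \<eta> - bexp p A F)))"
  proof (intro pmf_expectation_mono finite_set_bernoulli_field A)
    fix \<eta>
    show "indicator {\<eta>. F \<eta> \<ge> bexp p A F + s} \<eta> \<le> exp (- t * s) * exp (t * (F \<eta> - bexp p A F))"
      using t mult_left_mono[of s "F \<eta> - bexp p A F" t]
      by (auto simp: indicator_def simp flip: exp_add)
  qed
  also have "\<dots> = exp (- t * s) * bexp p A (\<lambda>\<eta>. exp (t * (F \<eta> - bexp p A F)))" by simp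
  also have "\<dots> \<le> exp (- t * s) * exp (real n * t\<^sup>2 * c\<^sup>2 / 8)"
    by (intro mult_left_mono bexp_exp_bounded_differences[OF A lev t diff]) auto
  also have "\<dots> = exp (- 2 * s\<^sup>2 / (n * c\<^sup>2))"
    using n c by (simp add: t_def field_simps power2_eq_square flip: exp_add)
  finally show ?thesis .
qed

lemma bounded_differences_lower_tail:
  fixes F :: "('a \<Rightarrow> bool) \<Rightarrow> real" and lev :: "'a \<Rightarrow> nat"
  assumes A: "finite A" and lev: "lev ` A \<subseteq> {1..n}" and n: "n > 0" and c: "c > 0" and s: "s > 0"
    and diff: "\<And>k \<eta> \<eta>'. (\<And>v. lev v \<noteq> k \<Longrightarrow> \<eta> v = \<eta>' v) \<Longrightarrow> F \<eta> \<le> F \<eta>' + c"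
  shows "measure_pmf.prob (bernoulli_field p A) {\<eta>. F \<eta> \<le> bexp p A F - s} \<le> exp (- 2 * s\<^sup>2 / (n * c\<^sup>2))"
proof -
  have "measure_pmf.prob (bernoulli_field p A) {\<eta>. - F \<eta> \<ge> bexp p A (\<lambda>\<eta>. - F \<eta>) + s}
      \<le> exp (- 2 * s\<^sup>2 / (n * c\<^sup>2))"
  proof (rule bounded_differences_upper_tail[OF A lev n c s])
    fix k and \<eta> \<eta>' :: "'a \<Rightarrow> bool" assume "\<And>v. lev v \<noteq> k \<Longrightarrow> \<eta> v = \<eta>' v"
    then show "- F \<eta> \<le> - F \<eta>' + c" using diff[of k \<eta>' \<eta>] by simp
  qed
  moreover have "{\<eta>. - F \<eta> \<ge> bexp p A (\<lambda>\<eta>. - F \<eta>) + s} = {\<eta>. F \<eta> \<le> bexp p A F - s}"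
    by (auto simp: A)
  ultimately show ?thesis by simp
qed

section \<open>Oriented paths\<close>

definition succs :: "'d::finite vertex \<Rightarrow> 'd vertex set" where
  "succs v = {u. edge v u}"

definition steps :: "(int ^ 'd::finite) set" where
  "steps = range (\<lambda>i. axis i 1) \<union> range (\<lambda>i. - axis i 1)"

definition wt :: "('d::finite vertex \<Rightarrow> bool) \<Rightarrow> 'd vertex list \<Rightarrow> nat" where
  "wt \<eta> \<pi> = card {i. 1 \<le> i \<and> i < length \<pi> \<and> \<eta> (\<pi> ! i)}"

text \<open>
  The sites whose state can influence the weight of a path of length $n$ from $v$. The
  starting vertex itself is excluded because it does not contribute to the weight.
\<close>

definition reach :: "'d::finite vertex \<Rightarrow> nat \<Rightarrow> 'd vertex set" where
  "reach v n = {\<pi> ! i |\<pi> i. \<pi> \<in> paths v n \<and> 1 \<le> i \<and> i \<le> n}"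

lemma weight_eq_wt: "weight b x \<pi> = wt (\<lambda>v. x v = exp b) \<pi>"
  by (simp add: weight_def wt_def)

lemma axis_1_neq_uminus: "axis i (1::int) \<noteq> - axis j 1"
proof
  assume "axis i (1::int) = - axis j 1"
  then have "axis i (1::int) $ i = (- axis j 1) $ i" by simp
  then show False by (auto simp: axis_def split: if_splits)
qed

lemma inj_axis_1: "inj (\<lambda>i. axis i (1::int))"
  by (auto simp: inj_def axis_eq_axis)

lemma finite_steps [simp]: "finite steps"
  by (simp add: steps_def)

lemma sum_steps:
  "(\<Sum>s\<in>steps. f s) = (\<Sum>i\<in>(UNIV :: 'd::finite set). f (axis i 1) + f (- axis i 1))"
proof -
  have "(\<Sum>s\<in>steps. f s) = (\<Sum>s\<in>range (\<lambda>i::'d. axis i 1). f s) + (\<Sum>s\<in>range (\<lambda>i::'d. - axis i 1). f s)"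
    unfolding steps_def by (rule sum.union_disjoint) (auto simp: axis_1_neq_uminus)
  also have "(\<Sum>s\<in>range (\<lambda>i::'d. axis i 1). f s) = (\<Sum>i\<in>UNIV. f (axis i 1))"
    by (subst sum.reindex) (auto simp: inj_axis_1)
  also have "(\<Sum>s\<in>range (\<lambda>i::'d. - axis i 1). f s) = (\<Sum>i\<in>UNIV. f (- axis i 1))"
    by (subst sum.reindex) (auto simp: inj_def axis_eq_axis)
  finally show ?thesis by (simp add: sum.distrib)
qed

lemma card_steps: "card (steps :: (int ^ 'd::finite) set) = 2 * CARD('d)"
  using sum_steps[of "\<lambda>_ :: int ^ 'd. 1::nat"] by simp

lemma succs_eq: "succs v = (\<lambda>s. (fst v + s, Suc (snd v))) ` steps"
  unfolding succs_def edge_def steps_def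
  by (auto simp: image_iff prod_eq_iff)

lemma finite_succs [simp]: "finite (succs v)"
  by (simp add: succs_eq)

lemma sum_succs: "(\<Sum>u\<in>succs v. f u) = (\<Sum>s\<in>steps. f (fst v + s, Suc (snd v)))"
  unfolding succs_eq by (subst sum.reindex) (auto simp: inj_on_def)

lemma card_succs: "card (succs (v :: 'd::finite vertex)) = 2 * CARD('d)"
  unfolding succs_eq by (subst card_image) (auto simp: inj_on_def card_steps)

lemma succs_nonempty: "succs v \<noteq> {}"
  unfolding succs_eq by (auto simp: steps_def)

lemma snd_succs: "u \<in> succs v \<Longrightarrow> snd u = Suc (snd v)"
  by (auto simp: succs_eq)

lemma paths_0: "paths v 0 = {[v]}"
  by (auto simp: paths_def length_Suc_conv)

lemma paths_nonempty_list: "\<pi> \<in> paths v n \<Longrightarrow> \<pi> \<noteq> []"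
  by (auto simp: paths_def)

lemma paths_hd: "\<pi> \<in> paths v n \<Longrightarrow> hd \<pi> = v"
  using hd_conv_nth[OF paths_nonempty_list[of \<pi> v n]] by (simp add: paths_def)

lemma Cons_in_paths:
  "v # \<pi> \<in> paths v (Suc n) \<longleftrightarrow> (\<exists>u\<in>succs v. \<pi> \<in> paths u n)"
proof
  assume *: "v # \<pi> \<in> paths v (Suc n)"
  then have "edge v (\<pi> ! 0)" by (auto simp: paths_def)
  moreover have "\<pi> \<in> paths (\<pi> ! 0) n"
    using * by (auto simp: paths_def)
  ultimately show "\<exists>u\<in>succs v. \<pi> \<in> paths u n" unfolding succs_def by blast
next
  assume "\<exists>u\<in>succs v. \<pi> \<in> paths u n"
  then show "v # \<pi> \<in> paths v (Suc n)"
    by (auto simp: paths_def succs_def nth_Cons split: nat.splits)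
qed

lemma paths_Suc: "paths v (Suc n) = (\<Union>u\<in>succs v. (#) v ` paths u n)"
proof -
  have "\<pi> \<in> paths v (Suc n) \<longleftrightarrow> (\<exists>u\<in>succs v. \<exists>\<rho>\<in>paths u n. \<pi> = v # \<rho>)" for \<pi>
  proof (cases \<pi>)
    case Nil
    then show ?thesis by (auto simp: paths_def)
  next
    case (Cons w \<rho>)
    then have "\<pi> \<in> paths v (Suc n) \<Longrightarrow> w = v" by (auto simp: paths_def)
    then show ?thesis using Cons_in_paths[of v \<rho> n] Cons by auto
  qed
  then have "\<pi> \<in> paths v (Suc n) \<longleftrightarrow> \<pi> \<in> (\<Union>u\<in>succs v. (#) v ` paths u n)" for \<pi>
    unfolding UN_iff image_iff by blast
  then show ?thesis by blast
qed

lemma finite_paths [simp]: "finite (paths v n)"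
  by (induction n arbitrary: v) (auto simp: paths_0 paths_Suc)

lemma paths_nonempty: "paths v n \<noteq> {}"
proof (induction n arbitrary: v)
  case (Suc n)
  obtain u where "u \<in> succs v" using succs_nonempty by blast
  then show ?case using Suc[of u] unfolding paths_Suc by blast
qed (simp add: paths_0)

lemma sum_paths_Suc:
  "(\<Sum>\<pi>\<in>paths v (Suc n). f \<pi>) = (\<Sum>u\<in>succs v. \<Sum>\<pi>\<in>paths u n. f (v # \<pi>))"
proof -
  have "(\<Sum>\<pi>\<in>paths v (Suc n). f \<pi>) = (\<Sum>u\<in>succs v. \<Sum>\<pi>\<in>(#) v ` paths u n. f \<pi>)"
    unfolding paths_Suc
  proof (rule sum.UNION_disjoint)
    show "\<forall>u\<in>succs v. \<forall>w\<in>succs v. u \<noteq> w \<longrightarrow> (#) v ` paths u n \<inter> (#) v ` paths w n = {}"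
      using paths_hd by blast
  qed auto
  then show ?thesis by (simp add: sum.reindex inj_on_def)
qed

lemma path_level: "\<pi> \<in> paths v n \<Longrightarrow> i \<le> n \<Longrightarrow> snd (\<pi> ! i) = snd v + i"
  by (induction i) (auto simp: paths_def edge_def)

lemma length_path: "\<pi> \<in> paths v n \<Longrightarrow> length \<pi> = Suc n"
  by (simp add: paths_def)

lemma wt_Cons: "\<pi> \<in> paths u n \<Longrightarrow> wt \<eta> (v # \<pi>) = of_bool (\<eta> u) + wt \<eta> \<pi>"
proof -
  assume \<pi>: "\<pi> \<in> paths u n"
  then have len: "length \<pi> = Suc n" and u: "\<pi> ! 0 = u" by (auto simp: paths_def)
  have "{i. 1 \<le> i \<and> i < length (v # \<pi>) \<and> \<eta> ((v # \<pi>) ! i)} =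
      Suc ` {i. i < length \<pi> \<and> \<eta> (\<pi> ! i)}"
    by (auto simp: image_iff nth_Cons split: nat.splits) (metis Suc_pred less_Suc_eq_0_disj)+
  then have "wt \<eta> (v # \<pi>) = card {i. i < length \<pi> \<and> \<eta> (\<pi> ! i)}"
    unfolding wt_def by (simp add: card_image)
  also have "{i. i < length \<pi> \<and> \<eta> (\<pi> ! i)} =
      (if \<eta> u then {0} else {}) \<union> {i. 1 \<le> i \<and> i < length \<pi> \<and> \<eta> (\<pi> ! i)}"
    using u len by auto (metis One_nat_def Suc_leI neq0_conv)+
  also have "card \<dots> = of_bool (\<eta> u) + wt \<eta> \<pi>"
    unfolding wt_def by (subst card_Un_disjoint) auto
  finally show ?thesis .
qed

lemma wt_le: "\<pi> \<in> paths v n \<Longrightarrow> wt \<eta> \<pi> \<le> n"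
proof -
  assume "\<pi> \<in> paths v n"
  then have "{i. 1 \<le> i \<and> i < length \<pi> \<and> \<eta> (\<pi> ! i)} \<subseteq> {1..n}" by (auto simp: length_path)
  then show ?thesis unfolding wt_def using card_mono[of "{1..n}"] by fastforce
qed

text \<open>
  A path visits level $k$ only at the time \<^term>\<open>k - snd v\<close>, so only one summand of its weight can change.
\<close>

lemma wt_level_diff:
  assumes \<pi>: "\<pi> \<in> paths v n" and agree: "\<And>u. snd u \<noteq> k \<Longrightarrow> \<eta> u = \<eta>' u"
  shows "wt \<eta> \<pi> \<le> wt \<eta>' \<pi> + 1"
proof -
  have "{i. 1 \<le> i \<and> i < length \<pi> \<and> \<eta> (\<pi> ! i)} \<subseteq>
      insert (k - snd v) {i. 1 \<le> i \<and> i < length \<pi> \<and> \<eta>' (\<pi> ! i)}" (is "?A \<subseteq> insert _ ?B")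
  proof
    fix i assume i: "i \<in> ?A"
    then have "snd (\<pi> ! i) = snd v + i" using path_level[OF \<pi>, of i] length_path[OF \<pi>] by auto
    then show "i \<in> insert (k - snd v) ?B"
      using i agree[of "\<pi> ! i"] by (cases "snd v + i = k") auto
  qed
  then have "card ?A \<le> card (insert (k - snd v) ?B)" by (intro card_mono) auto
  also have "\<dots> \<le> card ?B + 1" by (simp add: card_insert_le_m1 card_insert_if)
  finally show ?thesis unfolding wt_def .
qed

lemma finite_reach [simp]: "finite (reach v n)"
proof -
  have "reach v n \<subseteq> (\<lambda>(\<pi>, i). \<pi> ! i) ` (paths v n \<times> {1..n})"
    by (force simp: reach_def)
  then show ?thesis by (rule finite_subset) auto
qed

lemma reach_level: "u \<in> reach v n \<Longrightarrow> snd v < snd u \<and> snd u \<le> snd v + n"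
  by (auto simp: reach_def path_level)

lemma succs_subset_reach: "succs v \<subseteq> reach v (Suc n)"
proof
  fix u assume u: "u \<in> succs v"
  obtain \<pi> where \<pi>: "\<pi> \<in> paths u n" using paths_nonempty by blast
  then have "v # \<pi> \<in> paths v (Suc n)" "(v # \<pi>) ! 1 = u"
    using u by (auto simp: Cons_in_paths) (auto simp: paths_def)
  moreover have "1 \<le> Suc n" by simp
  ultimately show "u \<in> reach v (Suc n)" unfolding reach_def by blast
qed

lemma reach_Suc: "u \<in> succs v \<Longrightarrow> reach u n \<subseteq> reach v (Suc n)"
proof
  fix w assume u: "u \<in> succs v" and "w \<in> reach u n"
  then obtain \<pi> i where *: "\<pi> \<in> paths u n" "1 \<le> i" "i \<le> n" "w = \<pi> ! i" by (auto simp: reach_def)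
  then have "v # \<pi> \<in> paths v (Suc n)" "(v # \<pi>) ! Suc i = w" using u by (auto simp: Cons_in_paths)
  moreover have "1 \<le> Suc i" "Suc i \<le> Suc n" using * by auto
  ultimately show "w \<in> reach v (Suc n)" unfolding reach_def by blast
qed

lemma reach_mono_Suc: "reach v n \<subseteq> reach v (Suc n)"
proof (induction n arbitrary: v)
  case 0
  show ?case by (auto simp: reach_def)
next
  case (Suc n)
  show ?case
  proof
    fix w assume "w \<in> reach v (Suc n)"
    then obtain \<pi> i where *: "\<pi> \<in> paths v (Suc n)" "1 \<le> i" "i \<le> Suc n" "w = \<pi> ! i"
      by (auto simp: reach_def)
    then obtain u \<rho> where u: "u \<in> succs v" "\<rho> \<in> paths u n" "\<pi> = v # \<rho>" by (auto simp: paths_Suc)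
    obtain j where j: "i = Suc j" using *(2) by (cases i) auto
    then have w: "w = \<rho> ! j" using * u by simp
    show "w \<in> reach v (Suc (Suc n))"
    proof (cases "j = 0")
      case True
      then have "w = u" using u(2) w by (simp add: paths_def)
      then show ?thesis using u(1) succs_subset_reach by blast
    next
      case False
      then have "1 \<le> j" "j \<le> n" using j *(3) by auto
      then have "w \<in> reach u n" unfolding reach_def using u(2) w by blast
      then show ?thesis using Suc[of u] reach_Suc[OF u(1), of "Suc n"] by blast
    qed
  qed
qed

lemma reach_mono: "m \<le> n \<Longrightarrow> reach v m \<subseteq> reach v n"
  by (rule lift_Suc_mono_le[of "reach v"]) (rule reach_mono_Suc)

lemma depends_on_wt: "\<pi> \<in> paths v n \<Longrightarrow> depends_on (reach v n) (\<lambda>\<eta>. wt \<eta> \<pi>)"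
proof -
  assume \<pi>: "\<pi> \<in> paths v n"
  have "wt \<eta> \<pi> = wt \<eta>' \<pi>" if "\<forall>u\<in>reach v n. \<eta> u = \<eta>' u" for \<eta> \<eta>'
  proof -
    have "\<pi> ! i \<in> reach v n" if "1 \<le> i" "i < length \<pi>" for i
    proof -
      have "i \<le> n" using that length_path[OF \<pi>] by simp
      then show ?thesis using \<pi> that(1) unfolding reach_def by blast
    qed
    then show ?thesis using that unfolding wt_def by (metis (no_types, lifting))
  qed
  then show ?thesis by (auto simp: depends_on_def)
qed

section \<open>Partition sums and maximal weights\<close>

definition partition_sum :: "real \<Rightarrow> ('d::finite vertex \<Rightarrow> bool) \<Rightarrow> nat \<Rightarrow> 'd vertex \<Rightarrow> real" where
  "partition_sum \<beta> \<eta> n v = (\<Sum>\<pi>\<in>paths v n. exp (\<beta> * real (wt \<eta> \<pi>)))"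

definition best_weight :: "('d::finite vertex \<Rightarrow> bool) \<Rightarrow> nat \<Rightarrow> 'd vertex \<Rightarrow> nat" where
  "best_weight \<eta> n v = Max (wt \<eta> ` paths v n)"

lemma partition_sum_0: "partition_sum \<beta> \<eta> 0 v = 1"
  by (simp add: partition_sum_def paths_0 wt_def)

lemma partition_sum_Suc:
  "partition_sum \<beta> \<eta> (Suc n) v =
     (\<Sum>u\<in>succs v. exp (\<beta> * of_bool (\<eta> u)) * partition_sum \<beta> \<eta> n u)"
  unfolding partition_sum_def sum_paths_Suc sum_distrib_left
  by (intro sum.cong refl) (simp add: wt_Cons distrib_left flip: exp_add)

lemma partition_sum_pos: "partition_sum \<beta> \<eta> n v > 0"
  unfolding partition_sum_def by (intro sum_pos) (auto simp: paths_nonempty)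

lemma partition_sum_depends: "depends_on (reach v n) (\<lambda>\<eta>. partition_sum \<beta> \<eta> n v)"
proof -
  have "partition_sum \<beta> \<eta> n v = partition_sum \<beta> \<eta>' n v"
    if "\<forall>u\<in>reach v n. \<eta> u = \<eta>' u" for \<eta> \<eta>'
  proof -
    have "wt \<eta> \<pi> = wt \<eta>' \<pi>" if "\<pi> \<in> paths v n" for \<pi>
      using depends_onD[OF depends_on_wt[OF that]] \<open>\<forall>u\<in>_. _\<close> by blast
    then show ?thesis unfolding partition_sum_def by simp
  qed
  then show ?thesis unfolding depends_on_def by blast
qed

lemma ln_partition_sum_level_diff:
  assumes agree: "\<And>u. snd u \<noteq> k \<Longrightarrow> \<eta> u = \<eta>' u" and \<beta>: "\<beta> \<ge> 0"
  shows "ln (partition_sum \<beta> \<eta> n v) \<le> ln (partition_sum \<beta> \<eta>' n v) + \<beta>"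
proof -
  have "partition_sum \<beta> \<eta> n v \<le> (\<Sum>\<pi>\<in>paths v n. exp (\<beta> * (real (wt \<eta>' \<pi>) + 1)))"
    unfolding partition_sum_def
  proof (intro sum_mono)
    fix \<pi> assume "\<pi> \<in> paths v n"
    then have "wt \<eta> \<pi> \<le> wt \<eta>' \<pi> + 1" by (rule wt_level_diff) (rule agree)
    then have "real (wt \<eta> \<pi>) \<le> real (wt \<eta>' \<pi>) + 1" by (simp flip: of_nat_Suc)
    then show "exp (\<beta> * real (wt \<eta> \<pi>)) \<le> exp (\<beta> * (real (wt \<eta>' \<pi>) + 1))"
      using \<beta> by (auto intro!: mult_left_mono)
  qed
  also have "\<dots> = partition_sum \<beta> \<eta>' n v * exp \<beta>"
    unfolding partition_sum_def sum_distrib_right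
    by (intro sum.cong refl) (simp add: distrib_left flip: exp_add)
  finally have "ln (partition_sum \<beta> \<eta> n v) \<le> ln (partition_sum \<beta> \<eta>' n v * exp \<beta>)"
    using partition_sum_pos[of \<beta> \<eta> n v] by simp
  then show ?thesis using partition_sum_pos[of \<beta> \<eta>' n v] by (simp add: ln_mult)
qed

lemma wt_le_best_weight: "\<pi> \<in> paths v n \<Longrightarrow> wt \<eta> \<pi> \<le> best_weight \<eta> n v"
  unfolding best_weight_def by (intro Max_ge) auto

lemma best_weight_attained: "\<exists>\<pi>\<in>paths v n. best_weight \<eta> n v = wt \<eta> \<pi>"
proof -
  have "best_weight \<eta> n v \<in> wt \<eta> ` paths v n"
    unfolding best_weight_def by (intro Max_in) (auto simp: paths_nonempty)
  then show ?thesis by auto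
qed

lemma best_weight_depends: "depends_on (reach v n) (\<lambda>\<eta>. best_weight \<eta> n v)"
proof -
  have "best_weight \<eta> n v = best_weight \<eta>' n v"
    if "\<forall>u\<in>reach v n. \<eta> u = \<eta>' u" for \<eta> \<eta>'
  proof -
    have "wt \<eta> \<pi> = wt \<eta>' \<pi>" if "\<pi> \<in> paths v n" for \<pi>
      using depends_onD[OF depends_on_wt[OF that]] \<open>\<forall>u\<in>_. _\<close> by blast
    then have "wt \<eta> ` paths v n = wt \<eta>' ` paths v n" by (intro image_cong refl)
    then show ?thesis unfolding best_weight_def by simp
  qed
  then show ?thesis unfolding depends_on_def by blast
qed

lemma best_weight_level_diff:
  assumes agree: "\<And>u. snd u \<noteq> k \<Longrightarrow> \<eta> u = \<eta>' u"
  shows "best_weight \<eta> n v \<le> best_weight \<eta>' n v + 1"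
proof -
  obtain \<pi> where \<pi>: "\<pi> \<in> paths v n" "best_weight \<eta> n v = wt \<eta> \<pi>"
    using best_weight_attained by blast
  have "wt \<eta> \<pi> \<le> wt \<eta>' \<pi> + 1" using \<pi>(1) by (rule wt_level_diff) (rule agree)
  then show ?thesis using \<pi> wt_le_best_weight[OF \<pi>(1), of \<eta>'] by simp
qed

lemma best_weight_le: "best_weight \<eta> n v \<le> n"
  using best_weight_attained[of v n \<eta>] wt_le by metis

lemma best_weight_step:
  "u \<in> succs v \<Longrightarrow> of_bool (\<eta> u) + best_weight \<eta> n u \<le> best_weight \<eta> (Suc n) v"
proof -
  assume u: "u \<in> succs v"
  obtain \<pi> where \<pi>: "\<pi> \<in> paths u n" "best_weight \<eta> n u = wt \<eta> \<pi>"
    using best_weight_attained by blast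
  then have "v # \<pi> \<in> paths v (Suc n)" using u by (auto simp: Cons_in_paths)
  from wt_le_best_weight[OF this, of \<eta>] show ?thesis using wt_Cons[OF \<pi>(1), of \<eta> v] \<pi>(2) by simp
qed

lemma best_weight_first_step:
  "\<exists>u\<in>succs v. best_weight \<eta> (Suc n) v \<le> of_bool (\<eta> u) + best_weight \<eta> n u"
proof -
  obtain \<pi> where \<pi>: "\<pi> \<in> paths v (Suc n)" "best_weight \<eta> (Suc n) v = wt \<eta> \<pi>"
    using best_weight_attained by blast
  then obtain u \<rho> where u: "u \<in> succs v" "\<rho> \<in> paths u n" "\<pi> = v # \<rho>"
    by (auto simp: paths_Suc)
  then show ?thesis using \<pi> wt_Cons[OF u(2), of \<eta> v] wt_le_best_weight[OF u(2), of \<eta>] by auto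
qed

section \<open>Translation invariance\<close>

definition translate :: "'d::finite vertex \<Rightarrow> 'd vertex \<Rightarrow> 'd vertex" where
  "translate v u = (fst v + fst u, snd v + snd u)"

lemma edge_translate: "edge (translate v u) (translate v w) \<longleftrightarrow> edge u w"
  by (auto simp: edge_def translate_def algebra_simps)

lemma paths_translate: "paths v n = map (translate v) ` paths origin n"
proof
  show "map (translate v) ` paths origin n \<subseteq> paths v n"
    by (auto simp: paths_def edge_translate) (simp add: translate_def origin_def)
  show "paths v n \<subseteq> map (translate v) ` paths origin n"
  proof (induction n)
    case 0
    show ?case by (simp add: paths_0 translate_def origin_def)
  next
    case (Suc n)
    show ?case
    proof
      fix \<pi> assume \<pi>: "\<pi> \<in> paths v (Suc n)"
      define \<rho> where "\<rho> = map (\<lambda>u. (fst u - fst v, snd u - snd v)) \<pi>"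
      have lev: "snd (\<pi> ! i) \<ge> snd v" if "i \<le> Suc n" for i
        using path_level[OF \<pi> that] by simp
      have sh: "translate v (\<rho> ! i) = \<pi> ! i" if "i \<le> Suc n" for i
        using lev[OF that] that length_path[OF \<pi>] by (simp add: \<rho>_def translate_def)
      have "map (translate v) \<rho> = \<pi>"
        using sh length_path[OF \<pi>] by (intro nth_equalityI) (auto simp: \<rho>_def)
      moreover have "\<rho> \<in> paths origin (Suc n)"
        unfolding paths_def
      proof (intro CollectI conjI allI impI)
        show "length \<rho> = Suc n + 1" using length_path[OF \<pi>] by (simp add: \<rho>_def)
        show "\<rho> ! 0 = origin" using \<pi> by (auto simp: \<rho>_def paths_def origin_def)
        fix i assume i: "i < Suc n"
        show "edge (\<rho> ! i) (\<rho> ! (i + 1))"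
          using \<pi> i sh[of i] sh[of "i + 1"] by (subst edge_translate[of v, symmetric]) (auto simp: paths_def)
      qed
      ultimately show "\<pi> \<in> map (translate v) ` paths origin (Suc n)" by force
    qed
  qed
qed

lemma inj_translate: "inj (translate v)"
  by (auto simp: inj_def translate_def prod_eq_iff)

lemma reach_translate: "reach v n = translate v ` reach origin n"
proof
  show "reach v n \<subseteq> translate v ` reach origin n"
  proof
    fix u assume "u \<in> reach v n"
    then obtain \<pi> i where *: "\<pi> \<in> paths origin n" "1 \<le> i" "i \<le> n" "u = map (translate v) \<pi> ! i"
      unfolding reach_def paths_translate[of v] by auto
    then have "u = translate v (\<pi> ! i)" by (simp add: length_path)
    then show "u \<in> translate v ` reach origin n" using * by (auto simp: reach_def)
  qed
  show "translate v ` reach origin n \<subseteq> reach v n"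
  proof
    fix u assume "u \<in> translate v ` reach origin n"
    then obtain \<pi> i where *: "\<pi> \<in> paths origin n" "1 \<le> i" "i \<le> n" "u = translate v (\<pi> ! i)"
      unfolding reach_def by auto
    then have "u = map (translate v) \<pi> ! i" by (simp add: length_path)
    then show "u \<in> reach v n" using * paths_translate[of v n] by (auto simp: reach_def)
  qed
qed

lemma wt_translate: "wt \<eta> (map (translate v) \<pi>) = wt (\<eta> \<circ> translate v) \<pi>"
  unfolding wt_def by (rule arg_cong[where f = card]) auto

lemma best_weight_translate: "best_weight \<eta> n v = best_weight (\<eta> \<circ> translate v) n origin"
  unfolding best_weight_def paths_translate[of v] image_image wt_translate ..

lemma bexp_best_weight_translate:
  fixes v :: "'d::finite vertex"
  assumes A: "finite A" "reach v n \<subseteq> A"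
  shows "bexp p A (\<lambda>\<eta>. best_weight \<eta> n v) =
         bexp p (reach (origin :: 'd vertex) n) (\<lambda>\<eta>. best_weight \<eta> n origin)"
proof -
  have dep: "depends_on (reach v n) (\<lambda>\<eta>. real (best_weight \<eta> n v))"
    using best_weight_depends[of v n] by (auto simp: depends_on_def)
  have law: "bernoulli_field p (reach origin n) = map_pmf (\<lambda>\<eta>. \<eta> \<circ> translate v) (bernoulli_field p (reach v n))"
    unfolding bernoulli_field_def
  proof (rule Pi_pmf_bij_betw)
    show "bij_betw (translate v) (reach origin n) (reach v n)"
      unfolding reach_translate[of v n] bij_betw_def
      using inj_on_subset[OF inj_translate] by blast
    show "translate v u \<notin> reach v n" if "u \<notin> reach origin n" for u
      unfolding reach_translate[of v n] using that injD[OF inj_translate] by blast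
  qed simp
  have "bexp p (reach (origin :: 'd vertex) n) (\<lambda>\<eta>. best_weight \<eta> n origin) =
      bexp p (reach v n) (\<lambda>\<eta>. best_weight (\<eta> \<circ> translate v) n origin)"
    by (simp add: law)
  also have "\<dots> = bexp p (reach v n) (\<lambda>\<eta>. best_weight \<eta> n v)"
    by (simp only: best_weight_translate[of _ n v])
  also have "\<dots> = bexp p A (\<lambda>\<eta>. best_weight \<eta> n v)"
    by (rule bexp_subset[OF A dep, symmetric])
  finally show ?thesis ..
qed

section \<open>First and second moments of the partition sum\<close>

definition site_mgf :: "real \<Rightarrow> real \<Rightarrow> real" where
  "site_mgf p \<beta> = 1 - p + p * exp \<beta>"

lemma site_mgf_pos: "0 \<le> p \<Longrightarrow> p \<le> 1 \<Longrightarrow> site_mgf p \<beta> > 0"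
  unfolding site_mgf_def by (cases "p = 0") (auto intro: add_nonneg_pos)

lemma bexp_sum:
  "finite A \<Longrightarrow> bexp p A (\<lambda>\<eta>. \<Sum>i\<in>I. F i \<eta>) = (\<Sum>i\<in>I. bexp p A (F i))"
  by (rule Bochner_Integration.integral_sum) simp

lemma bexp_partition_sum:
  fixes v :: "'d::finite vertex"
  assumes p: "0 \<le> p" "p \<le> 1" and A: "finite A" "reach v n \<subseteq> A"
  shows "bexp p A (\<lambda>\<eta>. partition_sum \<beta> \<eta> n v) = (2 * real CARD('d) * site_mgf p \<beta>) ^ n"
  using A(2)
proof (induction n arbitrary: v)
  case 0
  show ?case by (simp add: partition_sum_0)
next
  case (Suc n)
  have "bexp p A (\<lambda>\<eta>. partition_sum \<beta> \<eta> (Suc n) v) =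
      (\<Sum>u\<in>succs v. bexp p A (\<lambda>\<eta>. exp (\<beta> * of_bool (\<eta> u)) * partition_sum \<beta> \<eta> n u))"
    unfolding partition_sum_Suc by (rule bexp_sum[OF A(1)])
  also have "\<dots> = (\<Sum>u\<in>succs v. site_mgf p \<beta> * (2 * real CARD('d) * site_mgf p \<beta>) ^ n)"
  proof (intro sum.cong refl)
    fix u assume u: "u \<in> succs v"
    have uA: "u \<in> A" and rA: "reach u n \<subseteq> A"
      using u succs_subset_reach[of v n] reach_Suc[OF u, of n] Suc.prems by auto
    have "bexp p A (\<lambda>\<eta>. exp (\<beta> * of_bool (\<eta> u)) * partition_sum \<beta> \<eta> n u) =
        bexp p A (\<lambda>\<eta>. exp (\<beta> * of_bool (\<eta> u))) * bexp p A (\<lambda>\<eta>. partition_sum \<beta> \<eta> n u)"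
      by (rule bexp_mult[OF A(1) _ partition_sum_depends, of "{u}"])
         (auto simp: depends_on_def dest: reach_level)
    also have "bexp p A (\<lambda>\<eta>. exp (\<beta> * of_bool (\<eta> u))) = site_mgf p \<beta>"
      using bexp_single[OF A(1) uA p, of "\<lambda>c. exp (\<beta> * of_bool c)"] by (simp add: site_mgf_def)
    finally show "bexp p A (\<lambda>\<eta>. exp (\<beta> * of_bool (\<eta> u)) * partition_sum \<beta> \<eta> n u) =
        site_mgf p \<beta> * (2 * real CARD('d) * site_mgf p \<beta>) ^ n"
      using Suc.IH[OF rA] by simp
  qed
  finally show ?case by (simp add: card_succs)
qed

text \<open>
  Follow two paths step by step. If they step to different sites, the two new sites are
  independent and contribute $m(\beta)^2$; if they meet, the common site contributes
  $m(2\beta) \le R\,m(\beta)^2$. The difference of their positions thus performs a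
  random walk with reward $R$ at each visit to $0$, and a supersolution $h \ge 1$ of the corresponding
  one-step inequality dominates the normalised second moment at every length.
\<close>

lemma bexp_partition_sum_mult_le:
  fixes v v' :: "'d::finite vertex" and h :: "int ^ 'd \<Rightarrow> real"
  assumes p: "0 \<le> p" "p \<le> 1" and A: "finite A" "reach v n \<subseteq> A" "reach v' n \<subseteq> A"
    and lev: "snd v = snd v'"
    and h1: "\<And>x. h x \<ge> 1"
    and super: "\<And>x. (\<Sum>s\<in>steps. \<Sum>s'\<in>steps. (if x + s - s' = 0 then R else 1) * h (x + s - s'))
        \<le> (2 * real CARD('d))\<^sup>2 * h x"
    and R: "site_mgf p (2 * \<beta>) \<le> R * (site_mgf p \<beta>)\<^sup>2"
  shows "bexp p A (\<lambda>\<eta>. partition_sum \<beta> \<eta> n v * partition_sum \<beta> \<eta> n v')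
    \<le> (2 * real CARD('d) * site_mgf p \<beta>) ^ (2 * n) * h (fst v - fst v')"
  using A(2,3) lev
proof (induction n arbitrary: v v')
  case 0
  then show ?case using h1 by (simp add: partition_sum_0)
next
  case (Suc n)
  define D where "D = 2 * real CARD('d)"
  define m where "m = site_mgf p \<beta>"
  have m: "m > 0" unfolding m_def by (rule site_mgf_pos[OF p])
  define w where "w \<eta> u = exp (\<beta> * of_bool (\<eta> u))" for \<eta> :: "'d vertex \<Rightarrow> bool" and u
  have pair: "bexp p A (\<lambda>\<eta>. (w \<eta> u * w \<eta> u') * (partition_sum \<beta> \<eta> n u * partition_sum \<beta> \<eta> n u'))
      \<le> m\<^sup>2 * (D * m) ^ (2 * n) * ((if u = u' then R else 1) * h (fst u - fst u'))"
    if u: "u \<in> succs v" and u': "u' \<in> succs v'" for u u'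
  proof -
    have uA: "u \<in> A" "reach u n \<subseteq> A" and uA': "u' \<in> A" "reach u' n \<subseteq> A"
      using succs_subset_reach[of v n] reach_Suc[OF u, of n] u Suc.prems(1)
        succs_subset_reach[of v' n] reach_Suc[OF u', of n] u' Suc.prems(2) by auto
    have lu: "snd u = snd u'" using snd_succs[OF u] snd_succs[OF u'] Suc.prems(3) by simp
    have "bexp p A (\<lambda>\<eta>. (w \<eta> u * w \<eta> u') * (partition_sum \<beta> \<eta> n u * partition_sum \<beta> \<eta> n u')) =
        bexp p A (\<lambda>\<eta>. w \<eta> u * w \<eta> u') *
        bexp p A (\<lambda>\<eta>. partition_sum \<beta> \<eta> n u * partition_sum \<beta> \<eta> n u')"
    proof (rule bexp_mult[OF A(1)])
      show "depends_on {u, u'} (\<lambda>\<eta>. w \<eta> u * w \<eta> u')" by (auto simp: depends_on_def w_def)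
      show "depends_on (reach u n \<union> reach u' n) (\<lambda>\<eta>. partition_sum \<beta> \<eta> n u * partition_sum \<beta> \<eta> n u')"
        using partition_sum_depends[of u n \<beta>] partition_sum_depends[of u' n \<beta>]
        unfolding depends_on_def by (metis UnCI)
      show "{u, u'} \<inter> (reach u n \<union> reach u' n) = {}" using lu by (auto dest!: reach_level)
    qed
    also have "\<dots> \<le> (m\<^sup>2 * (if u = u' then R else 1)) * ((D * m) ^ (2 * n) * h (fst u - fst u'))"
    proof (rule mult_mono)
      show "bexp p A (\<lambda>\<eta>. w \<eta> u * w \<eta> u') \<le> m\<^sup>2 * (if u = u' then R else 1)"
      proof (cases "u = u'")
        case True
        have exp_double: "exp (2 * \<beta>) = exp \<beta> * exp \<beta>" by (metis exp_add mult_2)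
        have "bexp p A (\<lambda>\<eta>. w \<eta> u * w \<eta> u) = site_mgf p (2 * \<beta>)"
          using bexp_single[OF A(1) uA(1) p, of "\<lambda>c. exp (\<beta> * of_bool c) * exp (\<beta> * of_bool c)"]
          by (simp add: site_mgf_def w_def exp_double)
        then show ?thesis using R unfolding m_def True by (simp only: if_True refl mult.commute)
      next
        case False
        have single: "bexp p A (\<lambda>\<eta>. w \<eta> x) = m" if "x \<in> A" for x
          using bexp_single[OF A(1) that p, of "\<lambda>c. exp (\<beta> * of_bool c)"]
          by (simp add: site_mgf_def w_def m_def)
        have "bexp p A (\<lambda>\<eta>. w \<eta> u * w \<eta> u') = bexp p A (\<lambda>\<eta>. w \<eta> u) * bexp p A (\<lambda>\<eta>. w \<eta> u')"
          by (rule bexp_mult[OF A(1), of "{u}" _ "{u'}"])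
             (use False in \<open>auto simp: depends_on_def w_def\<close>)
        then show ?thesis using False single uA(1) uA'(1) by (simp add: power2_eq_square)
      qed
      show "bexp p A (\<lambda>\<eta>. partition_sum \<beta> \<eta> n u * partition_sum \<beta> \<eta> n u')
          \<le> (D * m) ^ (2 * n) * h (fst u - fst u')"
        unfolding D_def m_def by (rule Suc.IH[OF uA(2) uA'(2) lu])
      have "0 \<le> R * m\<^sup>2" using R site_mgf_pos[OF p, of "2 * \<beta>"] by (simp add: m_def)
      then show "0 \<le> m\<^sup>2 * (if u = u' then R else 1)" by (simp only: mult.commute split: if_split) simp
      show "0 \<le> bexp p A (\<lambda>\<eta>. partition_sum \<beta> \<eta> n u * partition_sum \<beta> \<eta> n u')"
        by (intro Bochner_Integration.integral_nonneg mult_nonneg_nonneg less_imp_le[OF partition_sum_pos])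
    qed
    finally show ?thesis by (simp only: mult_ac)
  qed
  have "bexp p A (\<lambda>\<eta>. partition_sum \<beta> \<eta> (Suc n) v * partition_sum \<beta> \<eta> (Suc n) v') =
      bexp p A (\<lambda>\<eta>. \<Sum>u\<in>succs v. \<Sum>u'\<in>succs v'.
        (w \<eta> u * w \<eta> u') * (partition_sum \<beta> \<eta> n u * partition_sum \<beta> \<eta> n u'))"
    unfolding partition_sum_Suc sum_product w_def by (simp only: mult_ac)
  also have "\<dots> = (\<Sum>u\<in>succs v. \<Sum>u'\<in>succs v'. bexp p A (\<lambda>\<eta>.
        (w \<eta> u * w \<eta> u') * (partition_sum \<beta> \<eta> n u * partition_sum \<beta> \<eta> n u')))"
    by (simp add: bexp_sum A(1))
  also have "\<dots> \<le> (\<Sum>u\<in>succs v. \<Sum>u'\<in>succs v'.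
      m\<^sup>2 * (D * m) ^ (2 * n) * ((if u = u' then R else 1) * h (fst u - fst u')))"
    by (intro sum_mono pair)
  also have "\<dots> = m\<^sup>2 * (D * m) ^ (2 * n) * (\<Sum>s\<in>steps. \<Sum>s'\<in>steps.
      (if (fst v - fst v') + s - s' = 0 then R else 1) * h ((fst v - fst v') + s - s'))"
    unfolding sum_succs sum_distrib_left using Suc.prems(3)
    by (intro sum.cong refl) (simp add: algebra_simps)
  also have "\<dots> \<le> m\<^sup>2 * (D * m) ^ (2 * n) * (D\<^sup>2 * h (fst v - fst v'))"
    unfolding D_def by (intro mult_left_mono super) (use m in auto)
  also have "\<dots> = (D * m) ^ (2 * Suc n) * h (fst v - fst v')"
    by (simp add: power2_eq_square mult_ac)
  finally show ?case unfolding D_def m_def .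
qed

section \<open>A supersolution for the difference walk\<close>

definition sqnorm :: "int ^ 'd::finite \<Rightarrow> real" where
  "sqnorm x = (\<Sum>i\<in>UNIV. (real_of_int (x $ i))\<^sup>2)"

definition inv_sq :: "int ^ 'd::finite \<Rightarrow> real" where
  "inv_sq x = 1 / (sqnorm x + 2)"

lemma sqnorm_nonneg: "sqnorm x \<ge> 0"
  by (simp add: sqnorm_def sum_nonneg)

lemma coord_le_sqnorm: "(real_of_int (x $ i))\<^sup>2 \<le> sqnorm x"
  unfolding sqnorm_def by (rule member_le_sum) auto

lemma sqnorm_add_axis:
  fixes x :: "int ^ 'd::finite"
  shows "sqnorm (x + axis i c) = sqnorm x + 2 * of_int c * of_int (x $ i) + (of_int c)\<^sup>2"
proof -
  have "sqnorm (x + axis i c) = (\<Sum>j\<in>UNIV. (real_of_int (x $ j))\<^sup>2 +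
      (if j = i then 2 * of_int c * of_int (x $ i) + (of_int c)\<^sup>2 else 0))"
    unfolding sqnorm_def by (intro sum.cong refl) (auto simp: axis_def power2_eq_square algebra_simps)
  then show ?thesis by (simp add: sum.distrib sqnorm_def)
qed

text \<open>
  Put $T = |x|^2 + 3$. The two neighbours of $x$ in direction $i$ contribute
  $\frac{1}{T + 2x_i} + \frac{1}{T - 2x_i} = \frac2T (1 + \frac{4 x_i^2}{T^2 - 4x_i^2})$. Bounding $x_i^2$ by
  $|x|^2$ in the denominator and summing over $i$, the correction terms
  amount to at most $\frac{4}{T^2 - 4|x|^2}|x|^2 \le \frac{d}{T^2 - 4|x|^2}|x|^2$, which is where $d \ge 4$ enters.
  What remains is a polynomial inequality in $|x|^2$; the shift by $2$ in the
  definition of the function is large enough to make it strict for all $x$.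
\<close>

lemma inv_sq_superharmonic:
  fixes x :: "int ^ 'd::finite"
  assumes d: "CARD('d) \<ge> 4"
  shows "(\<Sum>s\<in>steps. inv_sq (x + s)) < 2 * real CARD('d) * inv_sq x"
proof -
  define N where "N = sqnorm x"
  define T where "T = N + 3"
  define d where "d = real CARD('d)"
  have N: "N \<ge> 0" unfolding N_def by (rule sqnorm_nonneg)
  have d4: "d \<ge> 4" using d by (simp add: d_def)
  have den: "T\<^sup>2 - 4 * N = N\<^sup>2 + 2 * N + 9" by (simp add: T_def power2_eq_square algebra_simps)
  have den_pos: "T\<^sup>2 - 4 * N > 0" unfolding den using N by (intro add_nonneg_pos) auto
  have T: "T > 0" using N by (simp add: T_def)
  have uminus_axis: "- axis i 1 = axis i (- 1 :: int)" for i :: 'd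
    by (simp add: vec_eq_iff axis_def)
  have pair: "inv_sq (x + axis i 1) + inv_sq (x + - axis i 1)
      \<le> 2 / T * (1 + 4 * (real_of_int (x $ i))\<^sup>2 / (T\<^sup>2 - 4 * N))" for i
  proof -
    define y where "y = real_of_int (x $ i)"
    have y: "y\<^sup>2 \<le> N" unfolding y_def N_def by (rule coord_le_sqnorm)
    have y1: "\<bar>2 * y\<bar> \<le> y\<^sup>2 + 1"
      using zero_le_power2[of "\<bar>y\<bar> - 1"] by (simp add: power2_diff abs_mult)
    have p1: "T + 2 * y > 0" and p2: "T - 2 * y > 0" using y y1 by (auto simp: T_def)
    have "inv_sq (x + axis i 1) + inv_sq (x + - axis i 1) = 1 / (T + 2 * y) + 1 / (T - 2 * y)"
      unfolding inv_sq_def uminus_axis sqnorm_add_axis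
      by (simp add: T_def N_def y_def algebra_simps)
    also have "\<dots> = 2 * T / (T\<^sup>2 - 4 * y\<^sup>2)"
      using p1 p2 by (simp add: field_simps power2_eq_square)
    also have "\<dots> = 2 / T * (1 + 4 * y\<^sup>2 / (T\<^sup>2 - 4 * y\<^sup>2))"
      using T y den_pos by (simp add: field_simps power2_eq_square)
    also have "\<dots> \<le> 2 / T * (1 + 4 * y\<^sup>2 / (T\<^sup>2 - 4 * N))"
      using T y den_pos by (intro mult_left_mono add_left_mono divide_left_mono mult_pos_pos) auto
    finally show ?thesis by (simp add: y_def)
  qed
  have "(\<Sum>s\<in>steps. inv_sq (x + s))
      \<le> (\<Sum>i\<in>UNIV. 2 / T * (1 + 4 * (real_of_int (x $ i))\<^sup>2 / (T\<^sup>2 - 4 * N)))"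
    unfolding sum_steps by (intro sum_mono pair)
  also have "\<dots> = 2 / T * (d + 4 * N / (T\<^sup>2 - 4 * N))"
    by (simp add: sum.distrib N_def sqnorm_def d_def
        flip: sum_distrib_left sum_divide_distrib)
  also have "\<dots> \<le> 2 / T * (d + d * N / (T\<^sup>2 - 4 * N))"
    using T N den_pos d4 by (intro mult_left_mono add_left_mono divide_right_mono mult_right_mono) auto
  also have "\<dots> = 2 * d * ((T\<^sup>2 - 3 * N) / (T * (T\<^sup>2 - 4 * N)))"
    using T den_pos by (simp add: field_simps)
  also have "\<dots> < 2 * d * (1 / (T - 1))"
  proof (intro mult_strict_left_mono)
    have "(T\<^sup>2 - 3 * N) * (T - 1) < T * (T\<^sup>2 - 4 * N)"
      using N by (simp add: T_def power2_eq_square algebra_simps)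
    then show "(T\<^sup>2 - 3 * N) / (T * (T\<^sup>2 - 4 * N)) < 1 / (T - 1)"
      using T den_pos N by (simp add: divide_simps) (simp add: T_def)
  qed (use d4 in auto)
  finally show ?thesis by (simp add: T_def N_def inv_sq_def d_def add.commute)
qed

lemma steps_uminus: "s \<in> steps \<longleftrightarrow> - s \<in> steps"
  unfolding steps_def by (metis (no_types, lifting) UnE UnI1 UnI2 minus_minus rangeE rangeI)

lemma sum_steps_uminus: "(\<Sum>s\<in>steps. f (- s)) = (\<Sum>s\<in>steps. f s)"
  by (rule sum.reindex_bij_witness[of _ uminus uminus]) (auto simp: steps_uminus[symmetric])

text \<open>
  One step of the difference walk is two steps of the simple random walk, so the
  function \<^const>\<open>inv_sq\<close> strictly decreases on average. The reward for hitting $0$ is felt only at the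
  finitely many $x$ from which $0$ is reachable in one step, and there the decrease is bounded below;
  a small reward cannot outweigh it. The constant $1$ is harmonic for the unrewarded walk and
  makes the supersolution bounded below.
\<close>

lemma supersolution_with_contact_reward:
  assumes d: "CARD('d::finite) \<ge> 4"
  shows "\<exists>\<epsilon>>0. \<forall>x :: int ^ 'd.
    (\<Sum>s\<in>steps. \<Sum>s'\<in>steps. (if x + s - s' = 0 then 1 + \<epsilon> else 1) * (1 + inv_sq (x + s - s')))
      \<le> (2 * real CARD('d))\<^sup>2 * (1 + inv_sq x)"
proof -
  define D where "D = 2 * real CARD('d)"
  have D: "D > 0" by (simp add: D_def)
  define gap where "gap = (\<lambda>x :: int ^ 'd. D\<^sup>2 * inv_sq x - (\<Sum>s\<in>steps. \<Sum>s'\<in>steps. inv_sq (x + s - s')))"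
  have gap: "gap x > 0" for x
  proof -
    have "(\<Sum>s\<in>steps. \<Sum>s'\<in>steps. inv_sq (x + s - s')) =
        (\<Sum>s\<in>steps. \<Sum>s'\<in>steps. inv_sq (x + s + s'))"
      using sum_steps_uminus[of "\<lambda>t. inv_sq (x + s + t)" for s] by simp
    also have "\<dots> \<le> (\<Sum>s\<in>steps. D * inv_sq (x + s))"
      unfolding D_def by (intro sum_mono less_imp_le inv_sq_superharmonic d)
    also have "\<dots> = D * (\<Sum>s\<in>steps. inv_sq (x + s))" by (simp add: sum_distrib_left)
    also have "\<dots> < D * (D * inv_sq x)"
      using inv_sq_superharmonic[OF d, of x] D by (simp add: D_def mult_ac)
    finally show ?thesis by (simp add: gap_def power2_eq_square)
  qed
  define K where "K = (\<lambda>(s, s'). s' - s) ` (steps \<times> (steps :: (int ^ 'd) set))"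
  have K: "finite K" "K \<noteq> {}" by (auto simp: K_def steps_def)
  \<comment> \<open>The reward costs at most $D^2 \epsilon\, (1 + f(0))$ with $f(0) = 1/2$, hence less than the smallest gap.\<close>
  define \<epsilon> where "\<epsilon> = Min (gap ` K) / (2 * D\<^sup>2)"
  have "Min (gap ` K) \<in> gap ` K" using K by (intro Min_in) auto
  then have "\<epsilon> > 0" using gap D unfolding \<epsilon>_def by auto
  have half: "inv_sq (0 :: int ^ 'd) = 1 / 2" by (simp add: inv_sq_def sqnorm_def)
  have "(\<Sum>s\<in>steps. \<Sum>s'\<in>steps. (if x + s - s' = 0 then 1 + \<epsilon> else 1) * (1 + inv_sq (x + s - s')))
      \<le> D\<^sup>2 * (1 + inv_sq x)" for x :: "int ^ 'd"
  proof -
    have "(\<Sum>s\<in>steps. \<Sum>s'\<in>steps. (if x + s - s' = 0 then 1 + \<epsilon> else 1) * (1 + inv_sq (x + s - s'))) =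
        (\<Sum>s\<in>steps. \<Sum>s'\<in>steps. (1 + inv_sq (x + s - s')) + (if x + s - s' = 0 then \<epsilon> * 3 / 2 else 0))"
      using half by (intro sum.cong refl) (auto simp: algebra_simps)
    also have "\<dots> = D\<^sup>2 + (\<Sum>s\<in>steps. \<Sum>s'\<in>steps. inv_sq (x + s - s')) +
        (\<Sum>s\<in>steps. \<Sum>s'\<in>steps. if x + s - s' = 0 then \<epsilon> * 3 / 2 else 0)"
      by (simp add: sum.distrib card_steps D_def power2_eq_square)
    also have "(\<Sum>s\<in>steps. \<Sum>s'\<in>steps. if x + s - s' = 0 then \<epsilon> * 3 / 2 else 0) \<le> gap x"
    proof (cases "x \<in> K")
      case True
      have "(\<Sum>s\<in>steps. \<Sum>s'\<in>steps. if x + s - s' = 0 then \<epsilon> * 3 / 2 else 0)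
          \<le> (\<Sum>s\<in>(steps :: (int ^ 'd) set). \<Sum>s'\<in>(steps :: (int ^ 'd) set). \<epsilon> * 2)"
        using \<open>\<epsilon> > 0\<close> by (intro sum_mono) auto
      also have "\<dots> = Min (gap ` K)"
        using D by (simp add: card_steps \<epsilon>_def D_def power2_eq_square field_simps)
      also have "\<dots> \<le> gap x" using True K by (intro Min_le) auto
      finally show ?thesis .
    next
      case False
      then have "x + s - s' \<noteq> 0" if "s \<in> steps" "s' \<in> steps" for s s'
        using that unfolding K_def by (force simp: algebra_simps)
      then have "(\<Sum>s\<in>steps. \<Sum>s'\<in>steps. if x + s - s' = 0 then \<epsilon> * 3 / 2 else 0) = 0"
        by (intro sum.neutral ballI) simp
      then show ?thesis using gap[of x] by simp
    qed
    finally show ?thesis by (simp add: gap_def algebra_simps)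
  qed
  then show ?thesis using \<open>\<epsilon> > 0\<close> unfolding D_def by blast
qed

text \<open>
  As $\beta \to 0$ the ratio $m(2\beta) / m(\beta)^2$ tends to $1$ and so falls below the
  admissible reward. The factor $2$ absorbs the value $3/2$ of the supersolution at $0$, where both
  paths start.
\<close>

lemma second_moment_bound_for_small_tilt:
  assumes d: "CARD('d::finite) \<ge> 4" and p: "0 < p" "p < 1"
  shows "\<exists>\<beta>1>0. \<forall>\<beta> A n. 0 \<le> \<beta> \<and> \<beta> < \<beta>1 \<and> finite A \<and> reach (origin :: 'd vertex) n \<subseteq> A \<longrightarrow>
    bexp p A (\<lambda>\<eta>. (partition_sum \<beta> \<eta> n origin)\<^sup>2) \<le> 2 * (bexp p A (\<lambda>\<eta>. partition_sum \<beta> \<eta> n origin))\<^sup>2"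
proof -
  obtain \<epsilon> where \<epsilon>: "\<epsilon> > 0" and super: "\<And>x :: int ^ 'd.
    (\<Sum>s\<in>steps. \<Sum>s'\<in>steps. (if x + s - s' = 0 then 1 + \<epsilon> else 1) * (1 + inv_sq (x + s - s')))
      \<le> (2 * real CARD('d))\<^sup>2 * (1 + inv_sq x)"
    using supersolution_with_contact_reward[OF d] by blast
  define g where "g = (\<lambda>\<beta>. (1 + \<epsilon>) * (site_mgf p \<beta>)\<^sup>2 - site_mgf p (2 * \<beta>))"
  have "isCont g 0" unfolding g_def site_mgf_def by (intro continuous_intros)
  moreover have "g 0 > 0" using \<epsilon> by (simp add: g_def site_mgf_def)
  ultimately have "eventually (\<lambda>\<beta>. g \<beta> > 0) (at 0)"
    unfolding isCont_def by (rule order_tendstoD)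
  then obtain \<beta>1 where \<beta>1: "\<beta>1 > 0" "\<And>\<beta>. \<beta> \<noteq> 0 \<Longrightarrow> \<bar>\<beta>\<bar> < \<beta>1 \<Longrightarrow> g \<beta> > 0"
    unfolding eventually_at by (auto simp: dist_real_def)
  have "bexp p A (\<lambda>\<eta>. (partition_sum \<beta> \<eta> n origin)\<^sup>2) \<le> 2 * (bexp p A (\<lambda>\<eta>. partition_sum \<beta> \<eta> n origin))\<^sup>2"
    if *: "0 \<le> \<beta>" "\<beta> < \<beta>1" "finite A" "reach (origin :: 'd vertex) n \<subseteq> A" for \<beta> A n
  proof -
    have "g \<beta> > 0" using \<beta>1(2)[of \<beta>] \<open>g 0 > 0\<close> * by (cases "\<beta> = 0") auto
    then have "site_mgf p (2 * \<beta>) \<le> (1 + \<epsilon>) * (site_mgf p \<beta>)\<^sup>2" by (simp add: g_def)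
    then have "bexp p A (\<lambda>\<eta>. partition_sum \<beta> \<eta> n origin * partition_sum \<beta> \<eta> n origin)
        \<le> (2 * real CARD('d) * site_mgf p \<beta>) ^ (2 * n) *
          (1 + inv_sq (fst (origin :: 'd vertex) - fst (origin :: 'd vertex)))"
      by (intro bexp_partition_sum_mult_le[where R = "1 + \<epsilon>" and h = "\<lambda>x. 1 + inv_sq x"])
         (use p * super in \<open>auto simp: inv_sq_def sqnorm_nonneg\<close>)
    also have "\<dots> \<le> (2 * real CARD('d) * site_mgf p \<beta>) ^ (2 * n) * 2"
      by (intro mult_left_mono) (auto simp: inv_sq_def sqnorm_def)
    also have "\<dots> = 2 * (bexp p A (\<lambda>\<eta>. partition_sum \<beta> \<eta> n origin))\<^sup>2"
      using bexp_partition_sum[of p A origin n \<beta>] * p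
      by (simp add: power_even_eq)
    finally show ?thesis by (simp add: power2_eq_square)
  qed
  then show ?thesis using \<beta>1(1) by blast
qed

text \<open>
  The special case of the inequality used below. Instead of Cauchy-Schwarz, the part of the mean where $f$ is
  large is bounded by $f \le f^2/(8\mu) + 2\mu$.
\<close>

lemma Paley_Zygmund:
  fixes f :: "'a \<Rightarrow> real"
  assumes fin: "finite (set_pmf P)" and pos: "measure_pmf.expectation P f > 0"
    and sq: "measure_pmf.expectation P (\<lambda>x. (f x)\<^sup>2) \<le> 2 * (measure_pmf.expectation P f)\<^sup>2"
  shows "measure_pmf.prob P {x. f x \<ge> measure_pmf.expectation P f / 2} \<ge> 1 / 8"
proof -
  define \<mu> where "\<mu> = measure_pmf.expectation P f"
  have \<mu>: "\<mu> > 0" using pos by (simp add: \<mu>_def)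
  have [simp]: "integrable (measure_pmf P) g" for g :: "'a \<Rightarrow> real"
    by (rule integrable_measure_pmf_finite[OF fin])
  have "\<mu> \<le> measure_pmf.expectation P (\<lambda>x. \<mu> / 2 + (f x)\<^sup>2 / (8 * \<mu>) + 2 * \<mu> * indicator {x. f x \<ge> \<mu> / 2} x)"
    unfolding \<mu>_def[symmetric] unfolding \<mu>_def
  proof (rule pmf_expectation_mono[OF fin])
    fix x
    have "f x \<le> (f x)\<^sup>2 / (8 * \<mu>) + 2 * \<mu>"
    proof -
      have "0 \<le> (f x - 4 * \<mu>)\<^sup>2 / (8 * \<mu>)" using \<mu> by simp
      also have "\<dots> = (f x)\<^sup>2 / (8 * \<mu>) - f x + 2 * \<mu>"
        using \<mu> by (simp add: field_simps power2_eq_square)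
      finally show ?thesis by simp
    qed
    moreover have "0 \<le> (f x)\<^sup>2 / (8 * \<mu>)" using \<mu> by simp
    ultimately have "f x \<le> \<mu> / 2 + (f x)\<^sup>2 / (8 * \<mu>) + 2 * \<mu> * (if f x \<ge> \<mu> / 2 then 1 else 0)"
      using \<mu> by (simp only: split: if_split) linarith
    then show "f x \<le> measure_pmf.expectation P f / 2 + (f x)\<^sup>2 / (8 * measure_pmf.expectation P f) +
        2 * measure_pmf.expectation P f * indicator {x. f x \<ge> measure_pmf.expectation P f / 2} x"
      unfolding \<mu>_def[symmetric] by (simp only: indicator_def mem_Collect_eq of_bool_def)
  qed
  also have "\<dots> = \<mu> / 2 + measure_pmf.expectation P (\<lambda>x. (f x)\<^sup>2) / (8 * \<mu>) +
      2 * \<mu> * measure_pmf.prob P {x. f x \<ge> \<mu> / 2}" by simp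
  also have "\<dots> \<le> \<mu> / 2 + 2 * \<mu>\<^sup>2 / (8 * \<mu>) + 2 * \<mu> * measure_pmf.prob P {x. f x \<ge> \<mu> / 2}"
    using sq \<mu> by (intro add_mono divide_right_mono) (auto simp: \<mu>_def)
  finally have "\<mu> * (1 / 8) \<le> \<mu> * measure_pmf.prob P {x. f x \<ge> \<mu> / 2}"
    using \<mu> by (simp add: power2_eq_square field_simps)
  then show ?thesis using \<mu> by (simp add: \<mu>_def)
qed

section \<open>Transfer to the i.i.d. environment\<close>

context iid_environment
begin

definition high :: "'w \<Rightarrow> 'd vertex \<Rightarrow> bool" where
  "high \<omega> v \<longleftrightarrow> X v \<omega> = exp b"

lemma X_measurable [measurable]: "X v \<in> borel_measurable M"
  using indep unfolding indep_vars_def by blast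

lemma p_range: "0 \<le> p" "p \<le> 1"
  using prob_high[of undefined] by (auto simp flip: prob_high[of undefined])

lemma prob_pattern:
  assumes A: "finite A" and g: "\<And>v. v \<notin> A \<Longrightarrow> \<not> g v"
  shows "prob {\<omega> \<in> space M. \<forall>v\<in>A. high \<omega> v = g v} = pmf (bernoulli_field p A) g"
proof -
  have site: "prob {\<omega> \<in> space M. high \<omega> v = c} = pmf (bernoulli_pmf p) c" for v c
  proof (cases c)
    case True
    then show ?thesis using prob_high[of v] p_range by (simp add: high_def)
  next
    case False
    have "{\<omega> \<in> space M. \<not> high \<omega> v} = space M - {\<omega> \<in> space M. X v \<omega> = exp b}"
      by (auto simp: high_def)
    then have "prob {\<omega> \<in> space M. \<not> high \<omega> v} = 1 - p"
      by (simp add: prob_compl prob_high)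
    then show ?thesis using False p_range by simp
  qed
  have pmf: "pmf (bernoulli_field p A) g = (\<Prod>v\<in>A. pmf (bernoulli_pmf p) (g v))"
    unfolding bernoulli_field_def by (rule pmf_Pi'[OF A]) (use g in auto)
  show ?thesis
  proof (cases "A = {}")
    case True
    then show ?thesis using pmf by (simp add: prob_space)
  next
    case False
    define S where "S v = (if g v then {exp b} else - {exp b :: real})" for v
    have pre: "X v -` S v \<inter> space M = {\<omega> \<in> space M. high \<omega> v = g v}" for v
      by (auto simp: S_def high_def)
    have "{\<omega> \<in> space M. \<forall>v\<in>A. high \<omega> v = g v} = (\<Inter>v\<in>A. X v -` S v \<inter> space M)"
      unfolding pre using False by auto
    also have "prob \<dots> = (\<Prod>v\<in>A. prob (X v -` S v \<inter> space M))"
      by (rule indep_varsD[OF indep False A]) (auto simp: S_def)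
    finally show ?thesis by (simp add: pre site pmf)
  qed
qed

text \<open>
  A function of finitely many sites takes finitely many values on the sample space, one for each pattern;
  measurability and expectation can be read off from this finite sum.
\<close>

lemma pattern_sum:
  fixes F :: "('d vertex \<Rightarrow> bool) \<Rightarrow> real"
  assumes A: "finite A" and F: "depends_on A F" and \<omega>: "\<omega> \<in> space M"
  shows "F (high \<omega>) = (\<Sum>g\<in>PiE_dflt A False (\<lambda>_. UNIV).
    F g * indicator {\<omega> \<in> space M. \<forall>v\<in>A. high \<omega> v = g v} \<omega>)"
proof -
  define h where "h = (\<lambda>v. v \<in> A \<and> high \<omega> v)"
  have h: "h \<in> PiE_dflt A False (\<lambda>_. UNIV)" by (auto simp: h_def PiE_dflt_def)
  have iff: "(\<forall>v\<in>A. high \<omega> v = g v) \<longleftrightarrow> g = h" if "g \<in> PiE_dflt A False (\<lambda>_. UNIV)" for g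
    using that by (auto simp: h_def PiE_dflt_def fun_eq_iff)
  have "(\<Sum>g\<in>PiE_dflt A False (\<lambda>_. UNIV).
      F g * indicator {\<omega> \<in> space M. \<forall>v\<in>A. high \<omega> v = g v} \<omega>) =
      (\<Sum>g\<in>PiE_dflt A False (\<lambda>_. UNIV). if g = h then F h else 0)"
    using \<omega> by (intro sum.cong refl) (auto simp: iff simp del: fun_eq_iff)
  also have "\<dots> = F h"
    using h A by (simp add: finite_PiE_dflt)
  also have "\<dots> = F (high \<omega>)" by (rule depends_onD[OF F]) (simp add: h_def)
  finally show ?thesis ..
qed

lemma pattern_measurable [measurable]:
  "finite A \<Longrightarrow> {\<omega> \<in> space M. \<forall>v\<in>A. high \<omega> v = g v} \<in> sets M"
  unfolding high_def by (intro sets.sets_Collect_finite_All) auto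

lemma depends_on_measurable:
  fixes F :: "('d vertex \<Rightarrow> bool) \<Rightarrow> real"
  assumes A: "finite A" and F: "depends_on A F"
  shows "(\<lambda>\<omega>. F (high \<omega>)) \<in> borel_measurable M"
proof -
  have "(\<lambda>\<omega>. \<Sum>g\<in>PiE_dflt A False (\<lambda>_. UNIV).
    F g * indicator {\<omega> \<in> space M. \<forall>v\<in>A. high \<omega> v = g v} \<omega>) \<in> borel_measurable M"
    using pattern_measurable[OF A] by (intro borel_measurable_sum borel_measurable_times borel_measurable_indicator) auto
  then show ?thesis by (subst measurable_cong[OF pattern_sum[OF A F]])
qed

lemma expectation_eq_bexp:
  fixes F :: "('d vertex \<Rightarrow> bool) \<Rightarrow> real"
  assumes A: "finite A" and F: "depends_on A F"
  shows "expectation (\<lambda>\<omega>. F (high \<omega>)) = bexp p A F"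
proof -
  let ?P = "PiE_dflt A False (\<lambda>_. UNIV) :: ('d vertex \<Rightarrow> bool) set"
  have fin: "finite ?P" using A by (intro finite_PiE_dflt) auto
  have "expectation (\<lambda>\<omega>. F (high \<omega>)) = expectation (\<lambda>\<omega>. \<Sum>g\<in>?P.
      F g * indicator {\<omega> \<in> space M. \<forall>v\<in>A. high \<omega> v = g v} \<omega>)"
    by (rule Bochner_Integration.integral_cong[OF refl pattern_sum[OF A F]])
  also have "\<dots> = (\<Sum>g\<in>?P. F g * prob {\<omega> \<in> space M. \<forall>v\<in>A. high \<omega> v = g v})"
    using pattern_measurable[OF A]
    by (subst Bochner_Integration.integral_sum) (auto intro!: sum.cong simp: integrable_real_indicator Int_def less_top[symmetric] conj_commute)
  also have "\<dots> = (\<Sum>g\<in>?P. F g * pmf (bernoulli_field p A) g)"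
    by (intro sum.cong refl) (subst prob_pattern[OF A], auto simp: PiE_dflt_def)
  also have "\<dots> = bexp p A F"
    by (rule integral_measure_pmf_real[symmetric])
       (use fin bernoulli_field_outside[OF A] in \<open>auto simp: PiE_dflt_def\<close>)
  finally show ?thesis .
qed

lemma prob_eq_bernoulli_field:
  assumes A: "finite A" and Q: "depends_on A Q"
  shows "{\<omega> \<in> space M. Q (high \<omega>)} \<in> sets M"
    and "prob {\<omega> \<in> space M. Q (high \<omega>)} = measure_pmf.prob (bernoulli_field p A) {\<eta>. Q \<eta>}"
proof -
  have dep: "depends_on A (\<lambda>\<eta>. of_bool (Q \<eta>) :: real)"
    using Q by (simp add: depends_on_def) metis
  have "(\<lambda>\<omega>. of_bool (Q (high \<omega>)) :: real) \<in> borel_measurable M"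
    by (rule depends_on_measurable[OF A dep])
  then have "{\<omega> \<in> space M. (of_bool (Q (high \<omega>)) :: real) = 1} \<in> sets M" by measurable
  then show meas: "{\<omega> \<in> space M. Q (high \<omega>)} \<in> sets M" by simp
  have "prob {\<omega> \<in> space M. Q (high \<omega>)} = expectation (indicator {\<omega> \<in> space M. Q (high \<omega>)})"
    using meas by (simp add: Int_absorb2 sets.sets_into_space)
  also have "\<dots> = expectation (\<lambda>\<omega>. of_bool (Q (high \<omega>)))"
    by (intro Bochner_Integration.integral_cong) (auto simp: indicator_def)
  also have "\<dots> = bexp p A (\<lambda>\<eta>. of_bool (Q \<eta>))" by (rule expectation_eq_bexp[OF A dep])
  also have "\<dots> = bexp p A (indicator {\<eta>. Q \<eta>})"
    by (intro pmf_expectation_cong) (auto simp: indicator_def)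
  finally show "prob {\<omega> \<in> space M. Q (high \<omega>)} = measure_pmf.prob (bernoulli_field p A) {\<eta>. Q \<eta>}" by simp
qed

text \<open>
  The probability that $F_n$ deviates from its mean by $\epsilon n$ is exponentially small in $n$, hence summable,
  and Borel-Cantelli applies.
\<close>

lemma AE_tendsto_of_bounded_differences:
  fixes F :: "nat \<Rightarrow> ('d vertex \<Rightarrow> bool) \<Rightarrow> real"
  assumes c: "c > 0" and dep: "\<And>n. depends_on (reach origin n) (F n)"
    and diff: "\<And>n k \<eta> \<eta>'. (\<And>v. snd v \<noteq> k \<Longrightarrow> \<eta> v = \<eta>' v) \<Longrightarrow> F n \<eta> \<le> F n \<eta>' + c"
    and lim: "(\<lambda>n. bexp p (reach origin n) (F n) / n) \<longlonglongrightarrow> L"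
  shows "AE \<omega> in M. (\<lambda>n. F n (high \<omega>) / n) \<longlonglongrightarrow> L"
proof -
  define E where "E n = bexp p (reach origin n) (F n)" for n
  have dev: "AE \<omega> in M. eventually (\<lambda>n. \<bar>F n (high \<omega>) / n - E n / n\<bar> < \<epsilon>) sequentially"
    if \<epsilon>: "\<epsilon> > 0" for \<epsilon>
  proof -
    define Q where "Q n \<eta> \<longleftrightarrow> n > 0 \<and> (F n \<eta> \<ge> E n + \<epsilon> * n \<or> F n \<eta> \<le> E n - \<epsilon> * n)" for n \<eta>
    have Q: "depends_on (reach origin n) (Q n)" for n
      unfolding depends_on_def
    proof (intro allI impI)
      fix \<eta> \<eta>' :: "'d vertex \<Rightarrow> bool" assume "\<forall>v\<in>reach origin n. \<eta> v = \<eta>' v"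
      then have "F n \<eta> = F n \<eta>'" using depends_onD[OF dep] by blast
      then show "Q n \<eta> = Q n \<eta>'" by (simp add: Q_def)
    qed
    define B where "B n = {\<omega> \<in> space M. Q n (high \<omega>)}" for n
    have B: "B n \<in> sets M" for n unfolding B_def by (rule prob_eq_bernoulli_field(1)[OF finite_reach Q])
    define q where "q = exp (- 2 * \<epsilon>\<^sup>2 / c\<^sup>2)"
    have bound: "prob (B n) \<le> 2 * q ^ n" for n
    proof (cases "n = 0")
      case True
      then show ?thesis by (simp add: B_def Q_def)
    next
      case False
      then have n: "n > 0" by simp
      have lev: "snd ` reach (origin :: 'd vertex) n \<subseteq> {1..n}"
        using reach_level[of _ "origin :: 'd vertex" n] by (force simp: origin_def)
      have s: "\<epsilon> * n > 0" using \<epsilon> n by simp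
      have expn: "exp (- 2 * (\<epsilon> * n)\<^sup>2 / (n * c\<^sup>2)) = q ^ n"
        unfolding q_def exp_of_nat_mult[symmetric] using n c by (simp add: field_simps power2_eq_square)
      have "prob (B n) = measure_pmf.prob (bernoulli_field p (reach origin n)) {\<eta>. Q n \<eta>}"
        unfolding B_def by (rule prob_eq_bernoulli_field(2)[OF finite_reach Q])
      also have "{\<eta>. Q n \<eta>} = {\<eta>. F n \<eta> \<ge> E n + \<epsilon> * n} \<union> {\<eta>. F n \<eta> \<le> E n - \<epsilon> * n}"
        using n by (auto simp: Q_def)
      also have "measure_pmf.prob (bernoulli_field p (reach origin n)) \<dots> \<le>
          measure_pmf.prob (bernoulli_field p (reach origin n)) {\<eta>. F n \<eta> \<ge> E n + \<epsilon> * n} +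
          measure_pmf.prob (bernoulli_field p (reach origin n)) {\<eta>. F n \<eta> \<le> E n - \<epsilon> * n}"
        by (rule measure_Un_le) auto
      also have "\<dots> \<le> q ^ n + q ^ n"
        unfolding E_def expn[symmetric]
        by (intro add_mono bounded_differences_upper_tail[OF finite_reach lev n c s diff]
              bounded_differences_lower_tail[OF finite_reach lev n c s diff])
      finally show ?thesis by simp
    qed
    have "norm q < 1" using \<epsilon> c by (simp add: q_def)
    then have "summable (\<lambda>n. 2 * q ^ n)" by (intro summable_mult summable_geometric)
    then have "summable (\<lambda>n. prob (B n))"
      by (rule summable_comparison_test'[where N = 0]) (use bound in auto)
    then have "AE \<omega> in M. eventually (\<lambda>n. \<omega> \<in> space M - B n) sequentially"
      by (intro borel_cantelli_AE1) (auto simp: B less_top[symmetric])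
    then show ?thesis
    proof eventually_elim
      case (elim \<omega>)
      then show ?case using eventually_gt_at_top[of 0]
      proof eventually_elim
        case (elim n)
        then have "\<bar>F n (high \<omega>) - E n\<bar> < \<epsilon> * n" by (auto simp: B_def Q_def abs_less_iff)
        then show ?case using elim(2) by (simp add: field_simps flip: diff_divide_distrib)
      qed
    qed
  qed
  have "AE \<omega> in M. \<forall>k. eventually (\<lambda>n. \<bar>F n (high \<omega>) / n - E n / n\<bar> < 1 / real (Suc k)) sequentially"
    unfolding AE_all_countable by (intro allI dev) simp
  then show ?thesis
  proof eventually_elim
    case (elim \<omega>)
    have "(\<lambda>n. F n (high \<omega>) / n - E n / n) \<longlonglongrightarrow> 0"
      unfolding tendsto_iff dist_real_def diff_0_right
    proof (intro allI impI)
      fix e :: real assume "e > 0"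
      then obtain k where "1 / real (Suc k) < e" using nat_approx_posE by blast
      with elim show "eventually (\<lambda>n. \<bar>F n (high \<omega>) / n - E n / n\<bar> < e) sequentially"
        by (auto elim!: allE[of _ k] eventually_mono)
    qed
    from tendsto_add[OF this lim[folded E_def]] show ?case by simp
  qed
qed

end

section \<open>The mean of the logarithm\<close>

text \<open>
  The upper bound is Jensen's inequality. If the mean of $\ln Z_n$ were smaller than
  $n\Lambda(\beta) - \ln 2$ by more than $c\sqrt{2n}$, then the event $Z_n \ge \frac12 E Z_n$ would be an
  upward deviation of size $c\sqrt{2n}$, of probability at most $e^{-4} < 1/8$, contradicting Paley-Zygmund.
\<close>

lemma bexp_ln_partition_sum_tendsto:
  assumes p: "0 < p" "p < 1" and \<beta>: "0 \<le> \<beta>"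
    and second: "\<And>n. bexp p (reach (origin :: 'd::finite vertex) n) (\<lambda>\<eta>. (partition_sum \<beta> \<eta> n origin)\<^sup>2)
      \<le> 2 * (bexp p (reach (origin :: 'd vertex) n) (\<lambda>\<eta>. partition_sum \<beta> \<eta> n origin))\<^sup>2"
  shows "(\<lambda>n. bexp p (reach (origin :: 'd vertex) n) (\<lambda>\<eta>. ln (partition_sum \<beta> \<eta> n origin)) / n)
    \<longlonglongrightarrow> ln (2 * real CARD('d) * site_mgf p \<beta>)"
proof -
  define P where "P n = bernoulli_field p (reach (origin :: 'd vertex) n)" for n
  define Z where "Z n \<eta> = partition_sum \<beta> \<eta> n (origin :: 'd vertex)" for n \<eta>
  define E where "E n = measure_pmf.expectation (P n) (\<lambda>\<eta>. ln (Z n \<eta>))" for n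
  define a where "a = 2 * real CARD('d) * site_mgf p \<beta>"
  have a: "a > 0" using site_mgf_pos[of p \<beta>] p by (simp add: a_def)
  have finP: "finite (set_pmf (P n))" for n unfolding P_def by (rule finite_set_bernoulli_field) simp
  have [simp]: "integrable (measure_pmf (P n)) f" for n and f :: "('d vertex \<Rightarrow> bool) \<Rightarrow> real"
    by (rule integrable_measure_pmf_finite[OF finP])
  have Zpos: "Z n \<eta> > 0" for n \<eta> unfolding Z_def by (rule partition_sum_pos)
  have EZ: "measure_pmf.expectation (P n) (Z n) = a ^ n" for n
    unfolding P_def Z_def a_def by (rule bexp_partition_sum) (use p in auto)
  have upper: "E n \<le> n * ln a" for n
  proof -
    have "E n \<le> measure_pmf.expectation (P n) (\<lambda>\<eta>. ln (a ^ n) + Z n \<eta> / a ^ n - 1)"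
      unfolding E_def
    proof (rule pmf_expectation_mono[OF finP])
      fix \<eta>
      have "ln (Z n \<eta> / a ^ n) \<le> Z n \<eta> / a ^ n - 1" by (rule ln_le_minus_one) (use Zpos a in simp)
      then show "ln (Z n \<eta>) \<le> ln (a ^ n) + Z n \<eta> / a ^ n - 1"
        using Zpos[of n \<eta>] a by (simp add: ln_div)
    qed
    also have "\<dots> = ln (a ^ n)" using a by (simp add: EZ)
    finally show ?thesis using a by (simp add: ln_realpow)
  qed
  \<comment> \<open>The difference bound $\beta$ is enlarged so that it is positive also for $\beta = 0$.\<close>
  define c where "c = \<beta> + 1"
  have c: "c > 0" using \<beta> by (simp add: c_def)
  have lower: "E n \<ge> n * ln a - ln 2 - c * sqrt (2 * n)" if n: "n > 0" for n
  proof (rule ccontr)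
    assume "\<not> ?thesis"
    then have less: "E n + c * sqrt (2 * n) \<le> n * ln a - ln 2" by simp
    define s where "s = c * sqrt (2 * n)"
    have s: "s > 0" using c n by (simp add: s_def)
    have lev: "snd ` reach (origin :: 'd vertex) n \<subseteq> {1..n}"
      using reach_level[of _ "origin :: 'd vertex" n] by (force simp: origin_def)
    have "1 / 8 \<le> measure_pmf.prob (P n) {\<eta>. Z n \<eta> \<ge> measure_pmf.expectation (P n) (Z n) / 2}"
      by (rule Paley_Zygmund[OF finP]) (use second[of n] a in \<open>simp_all add: EZ\<close>, simp add: P_def Z_def[symmetric] EZ[unfolded P_def])
    also have "\<dots> \<le> measure_pmf.prob (P n) {\<eta>. ln (Z n \<eta>) \<ge> E n + s}"
    proof (rule measure_pmf.finite_measure_mono)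
      show "{\<eta>. Z n \<eta> \<ge> measure_pmf.expectation (P n) (Z n) / 2} \<subseteq> {\<eta>. ln (Z n \<eta>) \<ge> E n + s}"
      proof safe
        fix \<eta> assume "Z n \<eta> \<ge> measure_pmf.expectation (P n) (Z n) / 2"
        then have "ln (a ^ n / 2) \<le> ln (Z n \<eta>)"
          using a Zpos[of n \<eta>] by (subst ln_le_cancel_iff) (auto simp: EZ)
        then show "ln (Z n \<eta>) \<ge> E n + s" using less a by (simp add: s_def ln_div ln_realpow)
      qed
    qed simp
    also have "\<dots> \<le> exp (- 2 * s\<^sup>2 / (n * c\<^sup>2))"
      unfolding P_def E_def
    proof (rule bounded_differences_upper_tail[OF finite_reach lev n c s])
      fix k and \<eta> \<eta>' :: "'d vertex \<Rightarrow> bool" assume agree: "\<And>v. snd v \<noteq> k \<Longrightarrow> \<eta> v = \<eta>' v"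
      have "ln (partition_sum \<beta> \<eta> n origin) \<le> ln (partition_sum \<beta> \<eta>' n origin) + \<beta>"
        by (rule ln_partition_sum_level_diff[OF _ \<beta>]) (rule agree)
      then show "ln (Z n \<eta>) \<le> ln (Z n \<eta>') + c" by (simp add: Z_def c_def)
    qed
    also have "- 2 * s\<^sup>2 / (n * c\<^sup>2) = - 4"
      using n c by (simp add: s_def power_mult_distrib)
    also have "exp (- 4 :: real) < 1 / 8"
    proof -
      have "(2 :: real) \<le> exp 1" using exp_ge_add_one_self[of 1] by simp
      then have "(2 :: real) ^ 4 \<le> exp 1 ^ 4" by (intro power_mono) auto
      also have "exp 1 ^ 4 = exp (4 :: real)" by (simp flip: exp_of_nat_mult)
      finally show ?thesis by (simp add: exp_minus field_simps)
    qed
    finally show False by simp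
  qed
  have "(\<lambda>n. E n / n) \<longlonglongrightarrow> ln a"
  proof (rule tendsto_sandwich)
    show "eventually (\<lambda>n. ln a - ln 2 / n - c * sqrt 2 / sqrt n \<le> E n / n) sequentially"
      using eventually_gt_at_top[of 0]
    proof eventually_elim
      case (elim n)
      have "(n * ln a - ln 2 - c * sqrt (2 * n)) / n \<le> E n / n"
        by (rule divide_right_mono) (use lower[OF elim] in auto)
      also have "(n * ln a - ln 2 - c * sqrt (2 * n)) / n = ln a - ln 2 / n - c * sqrt 2 / sqrt n"
        using elim by (simp add: real_sqrt_mult field_simps)
      finally show ?case .
    qed
    show "eventually (\<lambda>n. E n / n \<le> ln a) sequentially"
      using eventually_gt_at_top[of 0]
    proof eventually_elim
      case (elim n)
      then show ?case using upper[of n] by (simp add: field_simps)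
    qed
    have 1: "(\<lambda>n. ln 2 / real n) \<longlonglongrightarrow> 0" by (rule lim_const_over_n)
    have 2: "filterlim (\<lambda>n. sqrt (real n)) at_top sequentially"
      by (rule filterlim_compose[OF sqrt_at_top filterlim_real_sequentially])
    have 3: "(\<lambda>n. c * sqrt 2 / sqrt n) \<longlonglongrightarrow> 0"
      by (rule tendsto_divide_0[OF tendsto_const filterlim_at_top_imp_at_infinity[OF 2]])
    show "(\<lambda>n. ln a - ln 2 / n - c * sqrt 2 / sqrt n) \<longlonglongrightarrow> ln a"
      using tendsto_diff[OF tendsto_diff[OF tendsto_const[of "ln a"] 1] 3] by simp
  qed simp
  then show ?thesis by (simp add: E_def P_def Z_def a_def)
qed

section \<open>Existence of the maximal density\<close>

text \<open>
  Fekete's lemma in the form needed here: nonnegativity allows the remainder term to be dropped.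
\<close>

lemma superadditive_convergent:
  fixes a :: "nat \<Rightarrow> real" and C :: real
  assumes super: "\<And>m n. a (m + n) \<ge> a m + a n" and nonneg: "\<And>n. 0 \<le> a n" and bound: "\<And>n. a n \<le> C * n"
  shows "convergent (\<lambda>n. a n / n)"
proof -
  define L where "L = (SUP k\<in>{1..}. a k / k)"
  have bdd: "bdd_above ((\<lambda>k. a k / real k) ` {1..})"
    using bound by (intro bdd_aboveI[of _ C]) (auto simp: field_simps)
  have le_L: "a n / n \<le> L" if "n \<ge> 1" for n
    unfolding L_def using that by (intro cSUP_upper bdd) auto
  have mult: "q * a k \<le> a (q * k)" for q k
  proof (induction q)
    case (Suc q)
    then show ?case using super[of k "q * k"] by (simp add: algebra_simps)
  qed (use nonneg in simp)
  have "(\<lambda>n. a n / n) \<longlonglongrightarrow> L"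
  proof (rule order_tendstoI)
    fix l assume "L < l"
    show "eventually (\<lambda>n. a n / n < l) sequentially"
      using eventually_ge_at_top[of 1]
      by eventually_elim (use le_L \<open>L < l\<close> in \<open>auto intro: le_less_trans\<close>)
  next
    fix l assume "l < L"
    then obtain k where k: "k \<ge> 1" "l < a k / k"
      unfolding L_def using bdd by (subst (asm) less_cSUP_iff) auto
    have block: "a k / k * (1 - k / n) \<le> a n / n" if n: "n \<ge> 1" for n
    proof -
      have "n < n div k * k + k"
        using k(1) mod_less_divisor[of k n] div_mult_mod_eq[of n k] by linarith
      then have "real n - real k \<le> real (n div k * k)" by linarith
      then have "a k / k * (real n - real k) \<le> a k / k * real (n div k * k)"
        using nonneg[of k] by (intro mult_left_mono) auto
      also have "\<dots> = (n div k) * a k" using k(1) by simp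
      also have "\<dots> \<le> a (n div k * k)" by (rule mult)
      also have "\<dots> \<le> a n" using super[of "n div k * k" "n mod k"] nonneg[of "n mod k"] by simp
      finally have "a k / k * (real n - real k) / n \<le> a n / n" by (rule divide_right_mono) simp
      moreover have "(real n - real k) / n = 1 - k / n"
        using n by (simp add: diff_divide_distrib)
      ultimately show ?thesis by (metis times_divide_eq_right)
    qed
    have "(\<lambda>n. real k / real n) \<longlonglongrightarrow> 0" by (rule lim_const_over_n)
    then have "(\<lambda>n. a k / k * (1 - k / n)) \<longlonglongrightarrow> a k / k * (1 - 0)"
      by (intro tendsto_intros)
    then have "eventually (\<lambda>n. l < a k / k * (1 - k / n)) sequentially"
      using k(2) by (intro order_tendstoD) auto
    then show "eventually (\<lambda>n. l < a n / n) sequentially"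
      using eventually_ge_at_top[of 1] by eventually_elim (use block in \<open>auto intro: less_le_trans\<close>)
  qed
  then show ?thesis by (rule convergentI)
qed

lemma best_weight_0: "best_weight \<eta> 0 v = 0"
  by (simp add: best_weight_def paths_0 wt_def)

text \<open>
  Follow an optimal path of length $n$, which depends only on the levels up to $n$, and
  continue optimally from its endpoint. Given the lower levels, the mean gain of the continuation is $g(m)$
  whatever the endpoint, by translation invariance.
\<close>

lemma bexp_best_weight_superadditive:
  fixes p :: real
  defines "g \<equiv> (\<lambda>n. bexp p (reach (origin :: 'd::finite vertex) n) (\<lambda>\<eta>. real (best_weight \<eta> n origin)))"
  shows "g (n + m) \<ge> g n + g m"
proof -
  define A where "A = reach (origin :: 'd vertex) (n + m)"
  define B where "B = {u \<in> A. snd u \<le> n}"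
  define C where "C = {u \<in> A. snd u > n}"
  have A: "A = B \<union> C" and fin: "finite B" "finite C" "finite A" and BC: "B \<inter> C = {}"
    by (auto simp: A_def B_def C_def)
  \<comment> \<open>The lower levels are frozen in $\eta$; the induction runs backwards from level $n$, with $j$
    the number of steps left below it, and uses that a maximum of means is at most the mean of the maximum.\<close>
  have upper: "real (best_weight \<eta> j v) + g m \<le> bexp p C (\<lambda>\<zeta>. best_weight (merge B \<eta> \<zeta>) (j + m) v)"
    if "snd v + j = n" "reach v (j + m) \<subseteq> A" for j v \<eta>
    using that
  proof (induction j arbitrary: v)
    case 0
    have sub: "reach v m \<subseteq> C"
      using 0 reach_level[of _ v m] by (auto simp: C_def)
    have "best_weight (merge B \<eta> \<zeta>) m v = best_weight \<zeta> m v" for \<zeta>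
      by (rule depends_onD[OF best_weight_depends]) (use sub BC in \<open>auto simp: merge_def\<close>)
    then show ?case
      using bexp_best_weight_translate[OF fin(2) sub, of p] by (simp add: g_def best_weight_0)
  next
    case (Suc j)
    obtain u where u: "u \<in> succs v" "best_weight \<eta> (Suc j) v \<le> of_bool (\<eta> u) + best_weight \<eta> j u"
      using best_weight_first_step by blast
    have su: "snd u + j = n" using Suc.prems(1) snd_succs[OF u(1)] by simp
    have "u \<in> A" using Suc.prems(2) succs_subset_reach[of v "j + m"] u(1) by auto
    then have uB: "u \<in> B" using su by (simp add: B_def)
    have ru: "reach u (j + m) \<subseteq> A" using reach_Suc[OF u(1), of "j + m"] Suc.prems(2) by auto
    have "real (best_weight \<eta> (Suc j) v) + g m \<le> of_bool (\<eta> u) + (real (best_weight \<eta> j u) + g m)"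
      using of_nat_mono[OF u(2), where ?'a = real] by simp
    also have "\<dots> \<le> of_bool (\<eta> u) + bexp p C (\<lambda>\<zeta>. best_weight (merge B \<eta> \<zeta>) (j + m) u)"
      by (intro add_left_mono Suc.IH su ru)
    also have "\<dots> = bexp p C (\<lambda>\<zeta>. of_bool (\<eta> u) + real (best_weight (merge B \<eta> \<zeta>) (j + m) u))"
      by (simp add: fin)
    also have "\<dots> \<le> bexp p C (\<lambda>\<zeta>. best_weight (merge B \<eta> \<zeta>) (Suc j + m) v)"
    proof (rule pmf_expectation_mono[OF finite_set_bernoulli_field[OF fin(2)]])
      fix \<zeta>
      have "merge B \<eta> \<zeta> u = \<eta> u" using uB by (simp add: merge_def)
      then show "of_bool (\<eta> u) + real (best_weight (merge B \<eta> \<zeta>) (j + m) u)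
          \<le> best_weight (merge B \<eta> \<zeta>) (Suc j + m) v"
        using of_nat_mono[OF best_weight_step[OF u(1), of "merge B \<eta> \<zeta>" "j + m"], where ?'a = real] by simp
    qed
    finally show ?case .
  qed
  have sub: "reach (origin :: 'd vertex) n \<subseteq> B"
  proof
    fix u assume u: "u \<in> reach (origin :: 'd vertex) n"
    have "snd u \<le> n" using reach_level[OF u] by (simp add: origin_def)
    moreover have "u \<in> A" using u reach_mono[of n "n + m" origin] by (auto simp: A_def)
    ultimately show "u \<in> B" by (simp add: B_def)
  qed
  have "g n + g m = bexp p B (\<lambda>\<eta>. real (best_weight \<eta> n (origin :: 'd vertex)) + g m)"
    using bexp_best_weight_translate[OF fin(1) sub, of p] by (simp add: fin g_def)
  also have "\<dots> \<le> bexp p B (\<lambda>\<eta>. bexp p C (\<lambda>\<zeta>. best_weight (merge B \<eta> \<zeta>) (n + m) (origin :: 'd vertex)))"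
    by (intro pmf_expectation_mono finite_set_bernoulli_field fin upper) (auto simp: A_def origin_def)
  also have "\<dots> = bexp p A (\<lambda>\<eta>. best_weight \<eta> (n + m) (origin :: 'd vertex))"
    unfolding A by (rule bexp_union[OF fin(1,2) BC, symmetric])
  finally show ?thesis by (simp add: g_def A_def)
qed

lemma max_density_eq:
  fixes x :: "'d::finite vertex \<Rightarrow> real"
  shows "max_density b x s = best_weight (\<lambda>v. x v = exp b) s origin / s"
  unfolding max_density_def
proof (rule Max_eqI)
  show "finite ((\<lambda>\<pi>. real (weight b x \<pi>) / real s) ` paths origin s)" by simp
  fix y assume "y \<in> (\<lambda>\<pi>. real (weight b x \<pi>) / real s) ` paths origin s"
  then show "y \<le> best_weight (\<lambda>v. x v = exp b) s origin / s"
    by (auto simp: weight_eq_wt intro!: divide_right_mono wt_le_best_weight)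
next
  obtain \<pi> where "\<pi> \<in> paths origin s" "best_weight (\<lambda>v. x v = exp b) s origin = wt (\<lambda>v. x v = exp b) \<pi>"
    using best_weight_attained by blast
  then show "best_weight (\<lambda>v. x v = exp b) s origin / s \<in> (\<lambda>\<pi>. real (weight b x \<pi>) / real s) ` paths origin s"
    by (auto simp: weight_eq_wt)
qed

lemma (in iid_environment) M_eq_exists: "\<exists>m. M_eq M X b m"
proof -
  define g where "g n = bexp p (reach (origin :: 'd vertex) n) (\<lambda>\<eta>. real (best_weight \<eta> n origin))" for n
  have "convergent (\<lambda>n. g n / n)"
  proof (rule superadditive_convergent)
    show "g (m + n) \<ge> g m + g n" for m n
      unfolding g_def by (rule bexp_best_weight_superadditive)
    show "0 \<le> g n" for n unfolding g_def by (intro Bochner_Integration.integral_nonneg) simp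
    show "g n \<le> (1 :: real) * n" for n
    proof -
      have "g n \<le> bexp p (reach (origin :: 'd vertex) n) (\<lambda>_. real n)"
        unfolding g_def
        by (intro pmf_expectation_mono finite_set_bernoulli_field finite_reach of_nat_mono best_weight_le)
      then show ?thesis by simp
    qed
  qed
  then obtain m where m: "(\<lambda>n. g n / n) \<longlonglongrightarrow> m" unfolding convergent_def by blast
  have "AE \<omega> in M. (\<lambda>n. real (best_weight (high \<omega>) n origin) / n) \<longlonglongrightarrow> m"
  proof (rule AE_tendsto_of_bounded_differences[where c = 1])
    show "depends_on (reach origin n) (\<lambda>\<eta>. real (best_weight \<eta> n (origin :: 'd vertex)))" for n
      using best_weight_depends[of "origin :: 'd vertex" n] unfolding depends_on_def by metis
    fix n k and \<eta> \<eta>' :: "'d vertex \<Rightarrow> bool" assume agree: "\<And>v. snd v \<noteq> k \<Longrightarrow> \<eta> v = \<eta>' v"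
    have "best_weight \<eta> n origin \<le> best_weight \<eta>' n origin + 1"
      by (rule best_weight_level_diff) (rule agree)
    then show "real (best_weight \<eta> n origin) \<le> real (best_weight \<eta>' n origin) + 1" by simp
  qed (use m in \<open>simp_all add: g_def\<close>)
  then have "M_eq M X b m" unfolding M_eq_def max_density_eq high_def .
  then show ?thesis ..
qed

section \<open>From exponential moments to tails\<close>

lemma eventually_exp_le:
  fixes a :: "nat \<Rightarrow> real" and l u :: real
  assumes a: "\<And>n. a n > 0" and lim: "(\<lambda>n. ln (a n) / n) \<longlonglongrightarrow> l" and l: "l < u"
  shows "eventually (\<lambda>n. a n \<le> exp (n * u)) sequentially"
  using order_tendstoD(2)[OF lim l] eventually_gt_at_top[of 0]
proof eventually_elim
  case (elim n)
  then have "ln (a n) \<le> n * u" by (simp add: field_simps)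
  then show ?case using a[of n] by (metis exp_le_cancel_iff exp_ln)
qed

lemma eventually_exp_ge:
  fixes a :: "nat \<Rightarrow> real" and l u :: real
  assumes a: "\<And>n. a n > 0" and lim: "(\<lambda>n. ln (a n) / n) \<longlonglongrightarrow> l" and l: "u < l"
  shows "eventually (\<lambda>n. exp (n * u) \<le> a n) sequentially"
  using order_tendstoD(1)[OF lim l] eventually_gt_at_top[of 0]
proof eventually_elim
  case (elim n)
  then have "n * u \<le> ln (a n)" by (simp add: field_simps)
  then show ?case using a[of n] by (metis exp_le_cancel_iff exp_ln)
qed

text \<open>
  A sequence of measures on the integers up to $n$, not normalised, whose exponential moments have the growth rate
  $\Lambda$ on $[0, \beta_1)$. It is applied both to the numbers of paths with given weight in a fixed environment
  and to the means of these numbers.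
\<close>

locale exponential_weights =
  fixes \<mu> :: "nat \<Rightarrow> nat \<Rightarrow> real" and \<Lambda> q :: "real \<Rightarrow> real" and \<beta>1 :: real
  assumes \<mu>_nonneg: "\<And>n k. \<mu> n k \<ge> 0"
    and Z_pos: "\<And>n (\<beta> :: real). (\<Sum>k\<le>n. \<mu> n k * exp (\<beta> * k)) > 0"
    and Z_lim: "\<And>\<beta> :: real. 0 \<le> \<beta> \<Longrightarrow> \<beta> < \<beta>1 \<Longrightarrow>
      (\<lambda>n. ln (\<Sum>k\<le>n. \<mu> n k * exp (\<beta> * k)) / n) \<longlonglongrightarrow> \<Lambda> \<beta>"
    and \<Lambda>_deriv: "\<And>\<beta>. (\<Lambda> has_real_derivative q \<beta>) (at \<beta>)"
    and q_cont: "\<And>\<beta>. isCont q \<beta>"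
    and q_strict_mono: "strict_mono q"
begin

definition Z :: "nat \<Rightarrow> real \<Rightarrow> real" where
  "Z n \<beta> = (\<Sum>k\<le>n. \<mu> n k * exp (\<beta> * k))"

definition tail :: "nat \<Rightarrow> real \<Rightarrow> real" where
  "tail n \<alpha> = (\<Sum>k | k \<le> n \<and> \<alpha> * n \<le> k. \<mu> n k)"

lemma tail_le: "\<beta> \<ge> 0 \<Longrightarrow> tail n \<alpha> \<le> exp (- \<beta> * \<alpha> * n) * Z n \<beta>"
proof -
  assume \<beta>: "\<beta> \<ge> 0"
  have "tail n \<alpha> \<le> (\<Sum>k | k \<le> n \<and> \<alpha> * n \<le> k. exp (- \<beta> * \<alpha> * n) * (\<mu> n k * exp (\<beta> * k)))"
    unfolding tail_def
  proof (rule sum_mono)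
    fix k assume k: "k \<in> {k. k \<le> n \<and> \<alpha> * n \<le> k}"
    then have "\<beta> * (\<alpha> * n) \<le> \<beta> * k" using \<beta> by (intro mult_left_mono) auto
    then have "1 \<le> exp (- \<beta> * \<alpha> * n) * exp (\<beta> * k)" by (simp flip: exp_add)
    then show "\<mu> n k \<le> exp (- \<beta> * \<alpha> * n) * (\<mu> n k * exp (\<beta> * k))"
      using mult_left_mono[OF _ \<mu>_nonneg[of n k]] by (fastforce simp: mult_ac)
  qed
  also have "\<dots> \<le> (\<Sum>k\<le>n. exp (- \<beta> * \<alpha> * n) * (\<mu> n k * exp (\<beta> * k)))"
    by (rule sum_mono2) (auto intro!: mult_nonneg_nonneg \<mu>_nonneg)
  finally show ?thesis by (simp add: Z_def sum_distrib_left)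
qed

text \<open>
  Values below $\alpha n$ are controlled by lowering the tilt, values above $\alpha' n$ by raising it;
  in between, the exponential weight is at most $e^{\beta\alpha' n}$.
\<close>

lemma Z_split:
  assumes "\<delta>1 \<ge> 0" "\<delta>2 \<ge> 0" "\<beta> \<ge> 0"
  shows "Z n \<beta> \<le> exp (\<delta>1 * \<alpha> * n) * Z n (\<beta> - \<delta>1) + exp (- \<delta>2 * \<alpha>' * n) * Z n (\<beta> + \<delta>2)
    + exp (\<beta> * \<alpha>' * n) * tail n \<alpha>"
proof -
  define t where "t k = exp (\<delta>1 * \<alpha> * n) * (\<mu> n k * exp ((\<beta> - \<delta>1) * k))
      + exp (- \<delta>2 * \<alpha>' * n) * (\<mu> n k * exp ((\<beta> + \<delta>2) * k))
      + (if \<alpha> * n \<le> k then exp (\<beta> * \<alpha>' * n) * \<mu> n k else 0)" for k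
  have "\<mu> n k * exp (\<beta> * k) \<le> t k" for k
  proof -
    have ge: "exp (\<delta>1 * \<alpha> * n) * (\<mu> n k * exp ((\<beta> - \<delta>1) * k)) \<ge> 0"
      "exp (- \<delta>2 * \<alpha>' * n) * (\<mu> n k * exp ((\<beta> + \<delta>2) * k)) \<ge> 0"
      "(if \<alpha> * n \<le> k then exp (\<beta> * \<alpha>' * n) * \<mu> n k else 0) \<ge> 0"
      using \<mu>_nonneg by auto
    consider "k < \<alpha> * n" | "\<alpha>' * n < k" | "\<alpha> * n \<le> k" "k \<le> \<alpha>' * n" by linarith
    then show ?thesis
    proof cases
      case 1
      then have "\<beta> * k \<le> \<delta>1 * \<alpha> * n + (\<beta> - \<delta>1) * k"
        using assms(1) mult_left_mono[of k "\<alpha> * n" \<delta>1] by (simp add: algebra_simps)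
      then have "\<mu> n k * exp (\<beta> * k) \<le> \<mu> n k * (exp (\<delta>1 * \<alpha> * n) * exp ((\<beta> - \<delta>1) * k))"
        by (intro mult_left_mono \<mu>_nonneg) (simp flip: exp_add)
      then show ?thesis using ge unfolding t_def by (simp add: mult_ac)
    next
      case 2
      then have "\<beta> * k \<le> - \<delta>2 * \<alpha>' * n + (\<beta> + \<delta>2) * k"
        using assms(2) mult_left_mono[of "\<alpha>' * n" k \<delta>2] by (simp add: algebra_simps)
      then have "\<mu> n k * exp (\<beta> * k) \<le> \<mu> n k * (exp (- \<delta>2 * \<alpha>' * n) * exp ((\<beta> + \<delta>2) * k))"
        by (intro mult_left_mono \<mu>_nonneg) (simp flip: exp_add)
      then show ?thesis using ge unfolding t_def by (simp add: mult_ac)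
    next
      case 3
      then have "\<beta> * k \<le> \<beta> * \<alpha>' * n"
        using assms(3) mult_left_mono[of k "\<alpha>' * n" \<beta>] by (simp add: mult_ac)
      then have "\<mu> n k * exp (\<beta> * k) \<le> \<mu> n k * exp (\<beta> * \<alpha>' * n)"
        by (intro mult_left_mono \<mu>_nonneg) simp
      then show ?thesis using ge 3 unfolding t_def by (simp add: mult_ac)
    qed
  qed
  then have "Z n \<beta> \<le> (\<Sum>k\<le>n. t k)" unfolding Z_def by (intro sum_mono)
  also have "\<dots> = exp (\<delta>1 * \<alpha> * n) * Z n (\<beta> - \<delta>1) + exp (- \<delta>2 * \<alpha>' * n) * Z n (\<beta> + \<delta>2)
      + (\<Sum>k\<le>n. if \<alpha> * n \<le> k then exp (\<beta> * \<alpha>' * n) * \<mu> n k else 0)"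
    unfolding t_def Z_def by (simp add: sum.distrib sum_distrib_left)
  also have "(\<Sum>k\<le>n. if \<alpha> * n \<le> k then exp (\<beta> * \<alpha>' * n) * \<mu> n k else 0) = exp (\<beta> * \<alpha>' * n) * tail n \<alpha>"
    unfolding tail_def sum_distrib_left by (intro sum.mono_neutral_cong_right) auto
  finally show ?thesis .
qed

text \<open>
  Under the tilt $\beta$ the mass sits at $q(\beta) n$, where $q = \Lambda'$. For $\alpha < q(\beta) < \alpha'$ and
  small shifts of the tilt, differentiability of $\Lambda$ at $\beta$ makes the first two terms of the
  splitting exponentially smaller than $Z_n(\beta)$, so eventually the values between $\alpha n$ and
  $\alpha' n$ carry at least half of it.
\<close>

lemma tail_eventually_ge:
  assumes \<beta>: "0 < \<beta>" "\<beta> < \<beta>1" and \<alpha>: "\<alpha> < q \<beta>" and \<epsilon>: "\<epsilon> > 0"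
  shows "eventually (\<lambda>n. exp (n * (\<Lambda> \<beta> - \<beta> * q \<beta> - \<epsilon>)) \<le> tail n \<alpha>) sequentially"
proof -
  define \<alpha>' where "\<alpha>' = q \<beta> + \<epsilon> / (2 * \<beta>)"
  have \<alpha>': "q \<beta> < \<alpha>'" using \<epsilon> \<beta> by (simp add: \<alpha>'_def)
  have Zp: "Z n \<gamma> > 0" for n \<gamma> unfolding Z_def by (rule Z_pos)
  have Zl: "(\<lambda>n. ln (Z n \<gamma>) / n) \<longlonglongrightarrow> \<Lambda> \<gamma>" if "0 \<le> \<gamma>" "\<gamma> < \<beta>1" for \<gamma>
    unfolding Z_def by (rule Z_lim[OF that])
  have "((\<lambda>x. \<Lambda> x - \<alpha> * x) has_real_derivative q \<beta> - \<alpha>) (at \<beta>)"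
    by (auto intro!: derivative_eq_intros \<Lambda>_deriv)
  from DERIV_pos_inc_left[OF this] \<alpha> obtain d1 where
    d1: "d1 > 0" "\<And>h. 0 < h \<Longrightarrow> h < d1 \<Longrightarrow> \<Lambda> (\<beta> - h) - \<alpha> * (\<beta> - h) < \<Lambda> \<beta> - \<alpha> * \<beta>" by auto
  have "((\<lambda>x. \<Lambda> x - \<alpha>' * x) has_real_derivative q \<beta> - \<alpha>') (at \<beta>)"
    by (auto intro!: derivative_eq_intros \<Lambda>_deriv)
  from DERIV_neg_dec_right[OF this] \<alpha>' obtain d2 where
    d2: "d2 > 0" "\<And>h. 0 < h \<Longrightarrow> h < d2 \<Longrightarrow> \<Lambda> (\<beta> + h) - \<alpha>' * (\<beta> + h) < \<Lambda> \<beta> - \<alpha>' * \<beta>" by auto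
  define \<delta>1 where "\<delta>1 = min d1 \<beta> / 2"
  define \<delta>2 where "\<delta>2 = min d2 (\<beta>1 - \<beta>) / 2"
  have \<delta>1: "0 < \<delta>1" "\<delta>1 < d1" "\<delta>1 < \<beta>" using d1(1) \<beta> by (auto simp: \<delta>1_def min_def)
  have \<delta>2: "0 < \<delta>2" "\<delta>2 < d2" "\<delta>2 < \<beta>1 - \<beta>" using d2(1) \<beta> by (auto simp: \<delta>2_def min_def field_simps)
  have lo: "\<Lambda> (\<beta> - \<delta>1) + \<delta>1 * \<alpha> < \<Lambda> \<beta>" using d1(2)[OF \<delta>1(1,2)] by (simp add: algebra_simps)
  have hi: "\<Lambda> (\<beta> + \<delta>2) - \<delta>2 * \<alpha>' < \<Lambda> \<beta>" using d2(2)[OF \<delta>2(1,2)] by (simp add: algebra_simps)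
  \<comment> \<open>A quarter of the smallest exponential gap, so that the errors in all three growth rates can be absorbed.\<close>
  define \<kappa> where "\<kappa> = Min {\<Lambda> \<beta> - (\<Lambda> (\<beta> - \<delta>1) + \<delta>1 * \<alpha>), \<Lambda> \<beta> - (\<Lambda> (\<beta> + \<delta>2) - \<delta>2 * \<alpha>'), \<epsilon>} / 4"
  have \<kappa>: "\<kappa> > 0" "\<Lambda> (\<beta> - \<delta>1) + \<delta>1 * \<alpha> + 4 * \<kappa> \<le> \<Lambda> \<beta>" "\<Lambda> (\<beta> + \<delta>2) - \<delta>2 * \<alpha>' + 4 * \<kappa> \<le> \<Lambda> \<beta>" "4 * \<kappa> \<le> \<epsilon>"
    using lo hi \<epsilon> by (auto simp: \<kappa>_def)
  have ev1: "eventually (\<lambda>n. Z n (\<beta> - \<delta>1) \<le> exp (n * (\<Lambda> (\<beta> - \<delta>1) + \<kappa>))) sequentially"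
    by (rule eventually_exp_le[OF Zp Zl]) (use \<delta>1 \<beta> \<kappa> in auto)
  have ev2: "eventually (\<lambda>n. Z n (\<beta> + \<delta>2) \<le> exp (n * (\<Lambda> (\<beta> + \<delta>2) + \<kappa>))) sequentially"
    by (rule eventually_exp_le[OF Zp Zl]) (use \<delta>2 \<beta> \<kappa> in auto)
  have ev3: "eventually (\<lambda>n. exp (n * (\<Lambda> \<beta> - \<kappa>)) \<le> Z n \<beta>) sequentially"
    by (rule eventually_exp_ge[OF Zp Zl]) (use \<beta> \<kappa> in auto)
  have "(\<lambda>n. exp (- \<kappa>) ^ n) \<longlonglongrightarrow> 0" by (rule LIMSEQ_power_zero) (use \<kappa> in simp)
  then have ev4: "eventually (\<lambda>n. exp (- \<kappa>) ^ n < 1 / 4) sequentially"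
    by (rule order_tendstoD) simp
  show ?thesis
    using ev1 ev2 ev3 ev4
  proof eventually_elim
    case (elim n)
    have small: "exp (- \<kappa> * n) \<le> 1 / 4"
      using elim(4) by (simp add: exp_of_nat_mult[symmetric] mult.commute)
    have main: "exp (n * u) \<le> exp (n * (\<Lambda> \<beta> - \<kappa>)) / 4" if "u \<le> \<Lambda> \<beta> - 2 * \<kappa>" for u :: real
    proof -
      have "n * u \<le> n * (\<Lambda> \<beta> - \<kappa>) - \<kappa> * n"
        using mult_left_mono[OF that, of n] by (simp add: algebra_simps)
      then have "exp (n * u) \<le> exp (n * (\<Lambda> \<beta> - \<kappa>)) * exp (- \<kappa> * n)" by (simp flip: exp_add)
      also have "\<dots> \<le> exp (n * (\<Lambda> \<beta> - \<kappa>)) * (1 / 4)" by (intro mult_left_mono small) simp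
      finally show ?thesis by simp
    qed
    have low: "exp (\<delta>1 * \<alpha> * n) * Z n (\<beta> - \<delta>1) \<le> exp (n * (\<Lambda> \<beta> - \<kappa>)) / 4"
    proof -
      have "exp (\<delta>1 * \<alpha> * n) * Z n (\<beta> - \<delta>1) \<le> exp (\<delta>1 * \<alpha> * n) * exp (n * (\<Lambda> (\<beta> - \<delta>1) + \<kappa>))"
        by (intro mult_left_mono elim) simp
      also have "\<dots> = exp (n * (\<Lambda> (\<beta> - \<delta>1) + \<delta>1 * \<alpha> + \<kappa>))"
        by (simp add: algebra_simps flip: exp_add)
      also have "\<dots> \<le> exp (n * (\<Lambda> \<beta> - \<kappa>)) / 4" by (rule main) (use \<kappa> in linarith)
      finally show ?thesis .
    qed
    have high: "exp (- \<delta>2 * \<alpha>' * n) * Z n (\<beta> + \<delta>2) \<le> exp (n * (\<Lambda> \<beta> - \<kappa>)) / 4"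
    proof -
      have "exp (- \<delta>2 * \<alpha>' * n) * Z n (\<beta> + \<delta>2) \<le> exp (- \<delta>2 * \<alpha>' * n) * exp (n * (\<Lambda> (\<beta> + \<delta>2) + \<kappa>))"
        by (intro mult_left_mono elim) simp
      also have "\<dots> = exp (n * (\<Lambda> (\<beta> + \<delta>2) - \<delta>2 * \<alpha>' + \<kappa>))"
        by (simp add: algebra_simps flip: exp_add)
      also have "\<dots> \<le> exp (n * (\<Lambda> \<beta> - \<kappa>)) / 4" by (rule main) (use \<kappa> in linarith)
      finally show ?thesis .
    qed
    have "exp (n * (\<Lambda> \<beta> - \<kappa>)) \<le> exp (n * (\<Lambda> \<beta> - \<kappa>)) / 4 + exp (n * (\<Lambda> \<beta> - \<kappa>)) / 4 + exp (\<beta> * \<alpha>' * n) * tail n \<alpha>"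
      using Z_split[of \<delta>1 \<delta>2 \<beta> n \<alpha> \<alpha>'] \<delta>1 \<delta>2 \<beta> elim(3) low high by linarith
    then have "exp (n * (\<Lambda> \<beta> - \<kappa>)) / 4 \<le> exp (\<beta> * \<alpha>' * n) * tail n \<alpha>"
      using exp_gt_zero[of "n * (\<Lambda> \<beta> - \<kappa>)"] by linarith
    moreover have "exp (n * (\<Lambda> \<beta> - 2 * \<kappa>)) \<le> exp (n * (\<Lambda> \<beta> - \<kappa>)) / 4" by (rule main) simp
    ultimately have "exp (- (\<beta> * \<alpha>' * n)) * exp (n * (\<Lambda> \<beta> - 2 * \<kappa>)) \<le> exp (- (\<beta> * \<alpha>' * n)) * (exp (\<beta> * \<alpha>' * n) * tail n \<alpha>)"
      by (intro mult_left_mono) auto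
    also have "\<dots> = tail n \<alpha>" by (simp add: exp_minus)
    finally have "exp (n * (\<Lambda> \<beta> - \<beta> * \<alpha>' - 2 * \<kappa>)) \<le> tail n \<alpha>"
      by (simp add: algebra_simps flip: exp_add)
    moreover have "\<Lambda> \<beta> - \<beta> * q \<beta> - \<epsilon> \<le> \<Lambda> \<beta> - \<beta> * \<alpha>' - 2 * \<kappa>"
      using \<kappa>(4) \<beta> by (simp add: \<alpha>'_def algebra_simps)
    ultimately show ?case
      by (meson exp_le_cancel_iff mult_left_mono of_nat_0_le_iff order_trans)
  qed
qed

text \<open>
  The hypotheses on $\alpha$ cover the two regimes at once: either $\alpha = q(\beta)$, or $\beta = 0$ and
  $\alpha \le q(0)$, where the tail carries the full mass on the exponential scale. The lower bound uses tilts slightly above $\beta$,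
  which makes $\alpha < q$ strict.
\<close>

theorem tail_growth:
  assumes \<beta>: "0 \<le> \<beta>" "\<beta> < \<beta>1" and \<alpha>: "\<alpha> \<le> q \<beta>" and tilt: "\<beta> * \<alpha> = \<beta> * q \<beta>"
  shows "(\<lambda>n. tail n \<alpha> powr (1 / n)) \<longlonglongrightarrow> exp (\<Lambda> \<beta> - \<beta> * q \<beta>)"
proof -
  define I where "I \<gamma> = \<Lambda> \<gamma> - \<gamma> * q \<gamma>" for \<gamma>
  have "isCont \<Lambda> \<gamma>" for \<gamma> using \<Lambda>_deriv DERIV_isCont by blast
  then have I_cont: "isCont I \<gamma>" for \<gamma> unfolding I_def by (intro continuous_intros q_cont)
  have upper: "eventually (\<lambda>n. tail n \<alpha> powr (1 / n) \<le> exp (I \<beta> + \<epsilon>)) sequentially" if \<epsilon>: "\<epsilon> > 0" for \<epsilon>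
  proof -
    have "eventually (\<lambda>n. Z n \<beta> \<le> exp (n * (\<Lambda> \<beta> + \<epsilon>))) sequentially"
      by (rule eventually_exp_le) (use Z_pos Z_lim[OF \<beta>] \<epsilon> in \<open>auto simp: Z_def\<close>)
    then show ?thesis using eventually_gt_at_top[of 0]
    proof eventually_elim
      case (elim n)
      have "tail n \<alpha> \<le> exp (- \<beta> * \<alpha> * n) * Z n \<beta>" by (rule tail_le[OF \<beta>(1)])
      also have "\<dots> \<le> exp (- \<beta> * \<alpha> * n) * exp (n * (\<Lambda> \<beta> + \<epsilon>))" by (intro mult_left_mono elim) simp
      also have "\<dots> = exp (n * (I \<beta> + \<epsilon>))"
        using tilt by (auto simp: I_def algebra_simps simp flip: exp_add)
      finally have "tail n \<alpha> powr (1 / n) \<le> exp (n * (I \<beta> + \<epsilon>)) powr (1 / n)"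
        by (intro powr_mono2) (auto simp: tail_def intro!: sum_nonneg \<mu>_nonneg)
      also have "\<dots> = exp (I \<beta> + \<epsilon>)" using elim by (simp add: powr_def)
      finally show ?case .
    qed
  qed
  have lower: "eventually (\<lambda>n. exp (I \<beta> - \<epsilon>) \<le> tail n \<alpha> powr (1 / n)) sequentially" if \<epsilon>: "\<epsilon> > 0" for \<epsilon>
  proof -
    have "eventually (\<lambda>\<gamma>. I \<beta> - \<epsilon> / 2 < I \<gamma>) (at_right \<beta>)"
      using I_cont[of \<beta>] \<epsilon> by (intro order_tendstoD[of I "I \<beta>"]) (auto simp: isCont_def intro: filterlim_mono at_le)
    moreover have "eventually (\<lambda>\<gamma>. \<gamma> \<in> {\<beta><..<\<beta>1}) (at_right \<beta>)"
      by (rule eventually_at_right_real[OF \<beta>(2)])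
    ultimately have "eventually (\<lambda>\<gamma>. I \<beta> - \<epsilon> / 2 < I \<gamma> \<and> \<gamma> < \<beta>1 \<and> \<beta> < \<gamma>) (at_right \<beta>)"
      by eventually_elim simp
    then obtain \<gamma> where \<gamma>: "I \<beta> - \<epsilon> / 2 < I \<gamma>" "\<gamma> < \<beta>1" "\<beta> < \<gamma>"
      using eventually_happens'[OF trivial_limit_at_right_real] by blast
    have "\<alpha> < q \<gamma>" using strict_monoD[OF q_strict_mono \<gamma>(3)] \<alpha> by simp
    then have "eventually (\<lambda>n. exp (n * (\<Lambda> \<gamma> - \<gamma> * q \<gamma> - \<epsilon> / 2)) \<le> tail n \<alpha>) sequentially"
      by (intro tail_eventually_ge) (use \<gamma> \<beta> \<epsilon> in auto)
    then show ?thesis using eventually_gt_at_top[of 0]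
    proof eventually_elim
      case (elim n)
      have "exp (I \<beta> - \<epsilon>) \<le> exp (I \<gamma> - \<epsilon> / 2)" using \<gamma>(1) by simp
      also have "\<dots> = exp (n * (I \<gamma> - \<epsilon> / 2)) powr (1 / n)" using elim by (simp add: powr_def)
      also have "\<dots> \<le> tail n \<alpha> powr (1 / n)"
        using elim by (intro powr_mono2) (auto simp: I_def)
      finally show ?case .
    qed
  qed
  have "(\<lambda>n. tail n \<alpha> powr (1 / n)) \<longlonglongrightarrow> exp (I \<beta>)"
  proof (rule order_tendstoI)
    fix a assume a: "a < exp (I \<beta>)"
    show "eventually (\<lambda>n. a < tail n \<alpha> powr (1 / n)) sequentially"
    proof (cases "a > 0")
      case True
      then have "ln a < I \<beta>" using a by (metis exp_less_cancel_iff exp_ln)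
      then have "exp (ln a) < exp (I \<beta> - (I \<beta> - ln a) / 2)" by (simp add: field_simps)
      then have "a < exp (I \<beta> - (I \<beta> - ln a) / 2)" using True by simp
      with lower[of "(I \<beta> - ln a) / 2"] \<open>ln a < I \<beta>\<close> show ?thesis
        by (auto elim!: eventually_mono)
    next
      case False
      with lower[of 1] show ?thesis
        by (auto elim!: eventually_mono intro: less_le_trans[OF le_less_trans[OF _ exp_gt_zero]])
    qed
  next
    fix a assume a: "exp (I \<beta>) < a"
    then have "a > 0" using exp_gt_zero less_trans by blast
    then have "I \<beta> < ln a" using a by (metis exp_less_cancel_iff exp_ln)
    moreover have "exp (I \<beta> + (ln a - I \<beta>) / 2) < exp (ln a)"
      using \<open>I \<beta> < ln a\<close> by (simp add: field_simps)
    ultimately show "eventually (\<lambda>n. tail n \<alpha> powr (1 / n) < a) sequentially"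
      using upper[of "(ln a - I \<beta>) / 2"] \<open>a > 0\<close>
      by (auto elim!: eventually_mono)
  qed
  then show ?thesis by (simp add: I_def)
qed

end

section \<open>Growth of the number of heavy paths\<close>

definition log_mgf :: "nat \<Rightarrow> real \<Rightarrow> real \<Rightarrow> real" where
  "log_mgf d p \<beta> = ln (2 * real d * site_mgf p \<beta>)"

text \<open>
  The probability that a site is high under the law tilted by $e^\beta$; it is the derivative of
  \<^const>\<open>log_mgf\<close>, which plays the role of $\Lambda$.
\<close>

definition tilted_density :: "real \<Rightarrow> real \<Rightarrow> real" where
  "tilted_density p \<beta> = p * exp \<beta> / site_mgf p \<beta>"

lemma log_mgf_deriv:
  assumes "d > 0" "0 < p" "p < 1"
  shows "(log_mgf d p has_real_derivative tilted_density p \<beta>) (at \<beta>)"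
proof -
  have pos: "2 * real d * site_mgf p \<beta> > 0" using site_mgf_pos[of p \<beta>] assms by simp
  have "((\<lambda>\<beta>. 2 * real d * site_mgf p \<beta>) has_real_derivative 2 * real d * (p * exp \<beta>)) (at \<beta>)"
    unfolding site_mgf_def by (auto intro!: derivative_eq_intros)
  from DERIV_chain2[OF DERIV_ln_divide[OF pos] this] show ?thesis
    unfolding log_mgf_def tilted_density_def using assms(1) by (simp add: field_simps)
qed

lemma tilted_density_cont:
  assumes "0 < p" "p < 1"
  shows "isCont (tilted_density p) \<beta>"
  unfolding tilted_density_def site_mgf_def
  using site_mgf_pos[of p \<beta>] assms
  by (intro continuous_intros) (simp add: site_mgf_def)

lemma tilted_density_strict_mono:
  assumes p: "0 < p" "p < 1"
  shows "strict_mono (tilted_density p)"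
proof (rule strict_monoI)
  fix x y :: real assume "x < y"
  then have "site_mgf p x < site_mgf p y" using p by (simp add: site_mgf_def)
  then have "(1 - p) / site_mgf p y < (1 - p) / site_mgf p x"
    using p site_mgf_pos[of p x] site_mgf_pos[of p y] by (intro divide_strict_left_mono) auto
  moreover have "tilted_density p z = 1 - (1 - p) / site_mgf p z" for z
    using site_mgf_pos[of p z] p by (simp add: tilted_density_def site_mgf_def field_simps)
  ultimately show "tilted_density p x < tilted_density p y" by simp
qed

lemma tilted_density_0: "tilted_density p 0 = p"
  by (simp add: tilted_density_def site_mgf_def)

text \<open>
  Used to obtain one null set for all tilts from countably many almost sure limits.
\<close>

lemma tendsto_of_rational_tendsto_mono:
  fixes F :: "nat \<Rightarrow> real \<Rightarrow> real"
  assumes mono: "\<And>n x y. x \<le> y \<Longrightarrow> F n x \<le> F n y"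
    and lim: "\<And>r. r \<in> \<rat> \<Longrightarrow> 0 \<le> r \<Longrightarrow> r < c \<Longrightarrow> (\<lambda>n. F n r) \<longlonglongrightarrow> L r"
    and cont: "\<And>x. isCont L x" and x: "0 \<le> x" "x < c"
  shows "(\<lambda>n. F n x) \<longlonglongrightarrow> L x"
proof (cases "x = 0")
  case True
  then show ?thesis using lim[of 0] x by simp
next
  case False
  then have x0: "0 < x" using x by simp
  show ?thesis
  proof (rule order_tendstoI)
    fix l assume "l < L x"
    then have "eventually (\<lambda>r. l < L r) (at_left x)"
      using cont[of x] by (intro order_tendstoD[of L "L x"]) (auto simp: isCont_def intro: filterlim_mono at_le)
    then obtain e where e: "e < x" "\<And>r. e < r \<Longrightarrow> r < x \<Longrightarrow> l < L r"
      unfolding eventually_at_left[OF x0] by blast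
    obtain r where r: "r \<in> \<rat>" "max e 0 < r" "r < x" using Rats_dense_in_real[of "max e 0" x] e x0 by auto
    have "eventually (\<lambda>n. l < F n r) sequentially"
      by (rule order_tendstoD[OF lim]) (use r x e(2)[of r] in auto)
    then show "eventually (\<lambda>n. l < F n x) sequentially"
      by eventually_elim (use mono[of r x] r in \<open>auto intro: less_le_trans\<close>)
  next
    fix l assume "L x < l"
    then have "eventually (\<lambda>r. L r < l) (at_right x)"
      using cont[of x] by (intro order_tendstoD[of L "L x"]) (auto simp: isCont_def intro: filterlim_mono at_le)
    then obtain e where e: "x < e" "\<And>r. x < r \<Longrightarrow> r < e \<Longrightarrow> L r < l"
      unfolding eventually_at_right[OF x(2)] by blast
    obtain r where r: "r \<in> \<rat>" "x < r" "r < min e c" using Rats_dense_in_real[of x "min e c"] e x by auto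
    have "eventually (\<lambda>n. F n r < l) sequentially"
      by (rule order_tendstoD[OF lim]) (use r x e(2)[of r] in auto)
    then show "eventually (\<lambda>n. F n x < l) sequentially"
      by eventually_elim (use mono[of x r] r in \<open>auto intro: le_less_trans\<close>)
  qed
qed

definition path_count :: "('d::finite vertex \<Rightarrow> bool) \<Rightarrow> nat \<Rightarrow> nat \<Rightarrow> nat" where
  "path_count \<eta> n k = card {\<pi> \<in> paths origin n. wt \<eta> \<pi> = k}"

lemma sum_path_count:
  fixes \<phi> :: "nat \<Rightarrow> real"
  shows "(\<Sum>k\<le>n. path_count \<eta> n k * \<phi> k) = (\<Sum>\<pi>\<in>paths origin n. \<phi> (wt \<eta> \<pi>))"
proof -
  have "(\<Sum>\<pi>\<in>paths origin n. \<phi> (wt \<eta> \<pi>)) =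
      (\<Sum>k\<le>n. \<Sum>\<pi>\<in>{\<pi> \<in> paths origin n. wt \<eta> \<pi> = k}. \<phi> (wt \<eta> \<pi>))"
    by (intro sum.group[symmetric]) (auto intro: wt_le)
  also have "\<dots> = (\<Sum>k\<le>n. path_count \<eta> n k * \<phi> k)"
    by (intro sum.cong refl) (simp add: path_count_def)
  finally show ?thesis ..
qed

lemma path_count_mgf: "(\<Sum>k\<le>n. path_count \<eta> n k * exp (\<beta> * k)) = partition_sum \<beta> \<eta> n origin"
  unfolding partition_sum_def by (rule sum_path_count)

lemma path_count_tail:
  fixes \<alpha> :: real
  shows
  "(\<Sum>k | k \<le> n \<and> \<alpha> * n \<le> k. real (path_count (\<lambda>v. x v = exp b) n k)) = num_paths b x \<alpha> n"
proof -
  have "(\<Sum>k | k \<le> n \<and> \<alpha> * n \<le> k. real (path_count (\<lambda>v. x v = exp b) n k)) =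
      (\<Sum>k\<le>n. real (path_count (\<lambda>v. x v = exp b) n k) * of_bool (\<alpha> * n \<le> k))"
    by (intro sum.mono_neutral_cong_left) auto
  also have "\<dots> = (\<Sum>\<pi>\<in>paths origin n. of_bool (\<alpha> * n \<le> wt (\<lambda>v. x v = exp b) \<pi>))"
    by (rule sum_path_count)
  also have "\<dots> = num_paths b x \<alpha> n"
    by (simp add: num_paths_def weight_eq_wt Int_def)
  finally show ?thesis .
qed

lemma depends_on_path_count:
  "depends_on (reach (origin :: 'd::finite vertex) n) (\<lambda>\<eta>. path_count \<eta> n k)"
proof -
  have "path_count \<eta> n k = path_count \<eta>' n k"
    if agree: "\<forall>u\<in>reach (origin :: 'd vertex) n. \<eta> u = \<eta>' u" for \<eta> \<eta>'
  proof -
    have "wt \<eta> \<pi> = wt \<eta>' \<pi>" if "\<pi> \<in> paths origin n" for \<pi>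
      using depends_onD[OF depends_on_wt[OF that]] agree by blast
    then have "{\<pi> \<in> paths origin n. wt \<eta> \<pi> = k} = {\<pi> \<in> paths origin n. wt \<eta>' \<pi> = k}" by auto
    then show ?thesis by (simp add: path_count_def)
  qed
  then show ?thesis unfolding depends_on_def by blast
qed

lemma partition_sum_mono: "\<beta> \<le> \<gamma> \<Longrightarrow> partition_sum \<beta> \<eta> n v \<le> partition_sum \<gamma> \<eta> n v"
  unfolding partition_sum_def by (intro sum_mono) (auto intro: mult_right_mono)

context iid_environment
begin

lemma AE_ln_partition_sum:
  assumes p: "0 < p" "p < 1"
    and second: "\<And>\<beta> n. 0 \<le> \<beta> \<Longrightarrow> \<beta> < \<beta>1 \<Longrightarrow>
      bexp p (reach (origin :: 'd vertex) n) (\<lambda>\<eta>. (partition_sum \<beta> \<eta> n origin)\<^sup>2)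
        \<le> 2 * (bexp p (reach (origin :: 'd vertex) n) (\<lambda>\<eta>. partition_sum \<beta> \<eta> n origin))\<^sup>2"
  shows "AE \<omega> in M. \<forall>\<beta>. 0 \<le> \<beta> \<and> \<beta> < \<beta>1 \<longrightarrow>
    (\<lambda>n. ln (partition_sum \<beta> (high \<omega>) n origin) / n) \<longlonglongrightarrow> log_mgf CARD('d) p \<beta>"
proof -
  have fixed: "AE \<omega> in M. (\<lambda>n. ln (partition_sum \<beta> (high \<omega>) n origin) / n) \<longlonglongrightarrow> log_mgf CARD('d) p \<beta>"
    if \<beta>: "0 \<le> \<beta>" "\<beta> < \<beta>1" for \<beta>
  proof (rule AE_tendsto_of_bounded_differences[where c = "\<beta> + 1"])
    show "depends_on (reach origin n) (\<lambda>\<eta>. ln (partition_sum \<beta> \<eta> n (origin :: 'd vertex)))" for n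
      using partition_sum_depends[of "origin :: 'd vertex" n \<beta>] unfolding depends_on_def by metis
    show "(\<lambda>n. bexp p (reach origin n) (\<lambda>\<eta>. ln (partition_sum \<beta> \<eta> n (origin :: 'd vertex))) / n)
        \<longlonglongrightarrow> log_mgf CARD('d) p \<beta>"
      unfolding log_mgf_def by (rule bexp_ln_partition_sum_tendsto[OF p \<beta>(1) second[OF \<beta>]])
    fix n k and \<eta> \<eta>' :: "'d vertex \<Rightarrow> bool" assume agree: "\<And>v. snd v \<noteq> k \<Longrightarrow> \<eta> v = \<eta>' v"
    have "ln (partition_sum \<beta> \<eta> n origin) \<le> ln (partition_sum \<beta> \<eta>' n origin) + \<beta>"
      by (rule ln_partition_sum_level_diff[OF _ \<beta>(1)]) (rule agree)
    then show "ln (partition_sum \<beta> \<eta> n origin) \<le> ln (partition_sum \<beta> \<eta>' n origin) + (\<beta> + 1)" by simp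
  qed (use \<beta> in simp)
  have "AE \<omega> in M. \<forall>r\<in>\<rat> \<inter> {0..<\<beta>1}.
      (\<lambda>n. ln (partition_sum r (high \<omega>) n origin) / n) \<longlonglongrightarrow> log_mgf CARD('d) p r"
    by (intro AE_ball_countable' fixed) (auto intro: countable_rat countable_Int1)
  then show ?thesis
  proof eventually_elim
    case (elim \<omega>)
    show ?case
    proof (intro allI impI)
      fix \<beta> assume \<beta>: "0 \<le> \<beta> \<and> \<beta> < \<beta>1"
      show "(\<lambda>n. ln (partition_sum \<beta> (high \<omega>) n origin) / n) \<longlonglongrightarrow> log_mgf CARD('d) p \<beta>"
      proof (rule tendsto_of_rational_tendsto_mono[where c = \<beta>1
          and F = "\<lambda>n \<beta>. ln (partition_sum \<beta> (high \<omega>) n origin) / n"])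
        show "isCont (log_mgf CARD('d) p) x" for x
          using log_mgf_deriv[OF _ p] DERIV_isCont by (metis zero_less_card_finite)
        show "ln (partition_sum x (high \<omega>) n origin) / real n \<le> ln (partition_sum y (high \<omega>) n origin) / real n"
          if "x \<le> y" for n x y
          using partition_sum_mono[OF that, of "high \<omega>" n origin] partition_sum_pos[of _ "high \<omega>" n origin]
          by (intro divide_right_mono) (auto simp: ln_le_cancel_iff)
      qed (use elim \<beta> in auto)
    qed
  qed
qed

text \<open>
  The random counts and their means satisfy the hypotheses of \<^locale>\<open>exponential_weights\<close> with the same
  $\Lambda$; for the means the exponential moments are known exactly. Hence both tails have the same growth rate.
\<close>

lemma path_growth:
  assumes p: "0 < p" "p < 1"
    and second: "\<And>\<beta> n. 0 \<le> \<beta> \<Longrightarrow> \<beta> < \<beta>1 \<Longrightarrow>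
      bexp p (reach (origin :: 'd vertex) n) (\<lambda>\<eta>. (partition_sum \<beta> \<eta> n origin)\<^sup>2)
        \<le> 2 * (bexp p (reach (origin :: 'd vertex) n) (\<lambda>\<eta>. partition_sum \<beta> \<eta> n origin))\<^sup>2"
    and \<beta>: "0 \<le> \<beta>" "\<beta> < \<beta>1" and \<alpha>: "\<alpha> \<le> tilted_density p \<beta>" "\<beta> * \<alpha> = \<beta> * tilted_density p \<beta>"
  defines "c \<equiv> exp (log_mgf CARD('d) p \<beta> - \<beta> * tilted_density p \<beta>)"
  shows "lambda_eq M X b \<alpha> c" and "mean_growth M X b \<alpha> \<longlonglongrightarrow> c"
proof -
  have "AE \<omega> in M. \<forall>\<beta>. 0 \<le> \<beta> \<and> \<beta> < \<beta>1 \<longrightarrow>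
      (\<lambda>n. ln (partition_sum \<beta> (high \<omega>) n origin) / n) \<longlonglongrightarrow> log_mgf CARD('d) p \<beta>"
    by (rule AE_ln_partition_sum[OF p]) (rule second)
  then show "lambda_eq M X b \<alpha> c"
    unfolding lambda_eq_def
  proof eventually_elim
    case (elim \<omega>)
    interpret exponential_weights "\<lambda>n k. real (path_count (high \<omega>) n k)" "log_mgf CARD('d) p" "tilted_density p" \<beta>1
    proof
      show "(\<Sum>k\<le>n. real (path_count (high \<omega>) n k) * exp (\<gamma> * real k)) > 0" for n and \<gamma> :: real
        unfolding path_count_mgf by (rule partition_sum_pos)
      show "(\<lambda>n. ln (\<Sum>k\<le>n. real (path_count (high \<omega>) n k) * exp (\<gamma> * real k)) / n)
          \<longlonglongrightarrow> log_mgf CARD('d) p \<gamma>" if "0 \<le> \<gamma>" "\<gamma> < \<beta>1" for \<gamma>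
        unfolding path_count_mgf using elim that by blast
    qed (use p in \<open>auto intro: log_mgf_deriv tilted_density_cont tilted_density_strict_mono\<close>)
    have "tail n \<alpha> = num_paths b (\<lambda>v. X v \<omega>) \<alpha> n" for n
      unfolding tail_def high_def by (rule path_count_tail)
    then show ?case using tail_growth[OF \<beta> \<alpha>] by (simp add: c_def)
  qed
  define \<mu> where "\<mu> n k = bexp p (reach (origin :: 'd vertex) n) (\<lambda>\<eta>. real (path_count \<eta> n k))" for n k
  have mgf: "(\<Sum>k\<le>n. \<mu> n k * exp (\<gamma> * k)) = (2 * real CARD('d) * site_mgf p \<gamma>) ^ n" for n and \<gamma> :: real
  proof -
    have "(\<Sum>k\<le>n. \<mu> n k * exp (\<gamma> * k)) =
        bexp p (reach (origin :: 'd vertex) n) (\<lambda>\<eta>. \<Sum>k\<le>n. path_count \<eta> n k * exp (\<gamma> * k))"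
      by (simp add: bexp_sum \<mu>_def)
    also have "\<dots> = (2 * real CARD('d) * site_mgf p \<gamma>) ^ n"
      unfolding path_count_mgf by (rule bexp_partition_sum) (use p in auto)
    finally show ?thesis .
  qed
  have base_pos: "2 * real CARD('d) * site_mgf p \<gamma> > 0" for \<gamma>
    using site_mgf_pos[of p \<gamma>] p by simp
  interpret exponential_weights \<mu> "log_mgf CARD('d) p" "tilted_density p" \<beta>1
  proof
    show "\<mu> n k \<ge> 0" for n k unfolding \<mu>_def by (intro Bochner_Integration.integral_nonneg) simp
    show "(\<Sum>k\<le>n. \<mu> n k * exp (\<gamma> * k)) > 0" for n and \<gamma> :: real
      unfolding mgf using base_pos by simp
    show "(\<lambda>n. ln (\<Sum>k\<le>n. \<mu> n k * exp (\<gamma> * k)) / n) \<longlonglongrightarrow> log_mgf CARD('d) p \<gamma>" for \<gamma> :: real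
    proof (rule tendsto_eventually)
      show "eventually (\<lambda>n. ln (\<Sum>k\<le>n. \<mu> n k * exp (\<gamma> * k)) / n = log_mgf CARD('d) p \<gamma>) sequentially"
        using eventually_gt_at_top[of 0]
        by eventually_elim (simp only: mgf log_mgf_def ln_realpow, simp)
    qed
  qed (use p in \<open>auto intro: log_mgf_deriv tilted_density_cont tilted_density_strict_mono\<close>)
  have "mean_growth M X b \<alpha> = (\<lambda>n. tail n \<alpha> powr (1 / n))"
  proof
    fix n
    have dep: "depends_on (reach (origin :: 'd vertex) n)
        (\<lambda>\<eta>. \<Sum>k | k \<le> n \<and> \<alpha> * n \<le> k. real (path_count \<eta> n k))"
      unfolding depends_on_def
    proof (intro allI impI sum.cong refl)
      fix \<eta> \<eta>' :: "'d vertex \<Rightarrow> bool" and k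
      assume "\<forall>v\<in>reach origin n. \<eta> v = \<eta>' v"
      then have "path_count \<eta> n k = path_count \<eta>' n k"
        by (intro depends_onD[OF depends_on_path_count]) blast
      then show "real (path_count \<eta> n k) = real (path_count \<eta>' n k)" by simp
    qed
    have "(\<integral>\<omega>. real (num_paths b (\<lambda>v. X v \<omega>) \<alpha> n) \<partial>M) =
        expectation (\<lambda>\<omega>. \<Sum>k | k \<le> n \<and> \<alpha> * n \<le> k. real (path_count (high \<omega>) n k))"
      unfolding high_def path_count_tail ..
    also have "\<dots> = tail n \<alpha>"
      unfolding expectation_eq_bexp[OF finite_reach dep] tail_def \<mu>_def by (rule bexp_sum) simp
    finally show "mean_growth M X b \<alpha> n = tail n \<alpha> powr (1 / n)" by (simp add: mean_growth_def)
  qed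
  then show "mean_growth M X b \<alpha> \<longlonglongrightarrow> c" using tail_growth[OF \<beta> \<alpha>] by (simp add: c_def)
qed

lemma density_le_max_density_limit:
  assumes M: "M_eq M X b m" and lam: "lambda_eq M X b \<alpha> c" and c: "c > 0"
  shows "\<alpha> \<le> m"
proof -
  have "AE \<omega> in M. \<alpha> \<le> m"
    using M[unfolded M_eq_def] lam[unfolded lambda_eq_def]
  proof eventually_elim
    case (elim \<omega>)
    have "eventually (\<lambda>n. 0 < real (num_paths b (\<lambda>v. X v \<omega>) \<alpha> n) powr (1 / n)) sequentially"
      by (rule order_tendstoD(1)[OF elim(2) c])
    then have "eventually (\<lambda>n. \<alpha> \<le> max_density b (\<lambda>v. X v \<omega>) n) sequentially"
      using eventually_gt_at_top[of 0]
    proof eventually_elim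
      case (elim n)
      then have "{\<pi> \<in> paths origin n. real (weight b (\<lambda>v. X v \<omega>) \<pi>) \<ge> \<alpha> * real n} \<noteq> {}"
        by (auto simp: num_paths_def)
      then obtain \<pi> where \<pi>: "\<pi> \<in> paths origin n" "\<alpha> * n \<le> wt (high \<omega>) \<pi>"
        by (auto simp: weight_eq_wt high_def[abs_def])
      have "\<alpha> * n \<le> best_weight (high \<omega>) n origin"
        using \<pi>(2) wt_le_best_weight[OF \<pi>(1), of "high \<omega>"] by linarith
      then show ?case using elim(2) by (simp add: max_density_eq high_def[abs_def] field_simps)
    qed
    with elim(1) show ?case by (rule tendsto_lowerbound) simp
  qed
  then show ?thesis using eventually_happens'[OF ae_filter_bot] by blast
qed

end

theorem proposition4:
  fixes p :: real
  assumes "CARD('d::finite) \<ge> 4" and "0 < p" and "p < 1"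
  shows "\<exists>\<alpha>\<^sub>0 > p. \<forall>b > 0. \<forall>(M :: 'w measure) (X :: 'd vertex \<Rightarrow> 'w \<Rightarrow> real).
    iid_environment M X b p \<longrightarrow>
      (\<forall>\<alpha>. 0 \<le> \<alpha> \<and> \<alpha> < \<alpha>\<^sub>0 \<longrightarrow>
         convergent (mean_growth M X b \<alpha>) \<and> lambda_eq M X b \<alpha> (phi M X b \<alpha>)) \<and>
      (\<exists>m. M_eq M X b m \<and> m \<ge> \<alpha>\<^sub>0) \<and>
      (\<forall>\<alpha>. 0 \<le> \<alpha> \<and> \<alpha> < \<alpha>\<^sub>0 \<longrightarrow> (\<exists>c. lambda_eq M X b \<alpha> c))"
proof -
  note p = assms(2,3)
  obtain \<beta>1 where \<beta>1: "\<beta>1 > 0"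
    and range: "\<forall>\<beta> A n. 0 \<le> \<beta> \<and> \<beta> < \<beta>1 \<and> finite A \<and> reach (origin :: 'd vertex) n \<subseteq> A \<longrightarrow>
      bexp p A (\<lambda>\<eta>. (partition_sum \<beta> \<eta> n origin)\<^sup>2) \<le> 2 * (bexp p A (\<lambda>\<eta>. partition_sum \<beta> \<eta> n origin))\<^sup>2"
    using second_moment_bound_for_small_tilt[OF assms] by (elim exE conjE) (rule that; assumption)
  have second: "bexp p (reach (origin :: 'd vertex) n) (\<lambda>\<eta>. (partition_sum \<beta> \<eta> n origin)\<^sup>2)
        \<le> 2 * (bexp p (reach (origin :: 'd vertex) n) (\<lambda>\<eta>. partition_sum \<beta> \<eta> n origin))\<^sup>2"
    if "0 \<le> \<beta>" "\<beta> < \<beta>1" for \<beta> n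
    by (rule range[rule_format]) (use that in simp)
  define q where "q = tilted_density p"
  define \<alpha>0 where "\<alpha>0 = q \<beta>1"
  have \<alpha>0: "p < \<alpha>0"
    using strict_monoD[OF tilted_density_strict_mono[OF p] \<beta>1] by (simp add: \<alpha>0_def q_def tilted_density_0)
  have tilt: "\<exists>\<beta>. 0 \<le> \<beta> \<and> \<beta> < \<beta>1 \<and> \<alpha> \<le> q \<beta> \<and> \<beta> * \<alpha> = \<beta> * q \<beta>" if \<alpha>: "\<alpha> < \<alpha>0" for \<alpha>
  proof (cases "\<alpha> \<le> p")
    case True
    then show ?thesis using \<beta>1 by (intro exI[of _ 0]) (simp add: q_def tilted_density_0)
  next
    case False
    have "\<exists>\<beta>. 0 \<le> \<beta> \<and> \<beta> \<le> \<beta>1 \<and> q \<beta> = \<alpha>"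
      by (rule IVT) (use False \<alpha> \<beta>1 tilted_density_cont[OF p] in \<open>auto simp: q_def \<alpha>0_def tilted_density_0\<close>)
    then obtain \<beta> where \<beta>: "0 \<le> \<beta>" "\<beta> \<le> \<beta>1" "q \<beta> = \<alpha>" by blast
    then have "\<beta> \<noteq> \<beta>1" using \<alpha> by (auto simp: \<alpha>0_def)
    then show ?thesis using \<beta> by (intro exI[of _ \<beta>]) auto
  qed
  have main: "(\<forall>\<alpha>. 0 \<le> \<alpha> \<and> \<alpha> < \<alpha>0 \<longrightarrow>
         convergent (mean_growth M X b \<alpha>) \<and> lambda_eq M X b \<alpha> (phi M X b \<alpha>)) \<and>
      (\<exists>m. M_eq M X b m \<and> m \<ge> \<alpha>0) \<and>
      (\<forall>\<alpha>. 0 \<le> \<alpha> \<and> \<alpha> < \<alpha>0 \<longrightarrow> (\<exists>c. lambda_eq M X b \<alpha> c))"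
    if "iid_environment M X b p" for b and M :: "'w measure" and X :: "'d vertex \<Rightarrow> 'w \<Rightarrow> real"
  proof -
    interpret iid_environment M X b p by (rule that)
    have growth: "\<exists>c>0. lambda_eq M X b \<alpha> c \<and> mean_growth M X b \<alpha> \<longlonglongrightarrow> c" if \<alpha>: "\<alpha> < \<alpha>0" for \<alpha>
    proof -
      obtain \<beta> where \<beta>: "0 \<le> \<beta>" "\<beta> < \<beta>1" "\<alpha> \<le> tilted_density p \<beta>" "\<beta> * \<alpha> = \<beta> * tilted_density p \<beta>"
        using tilt[OF \<alpha>] by (auto simp: q_def)
      have "lambda_eq M X b \<alpha> (exp (log_mgf CARD('d) p \<beta> - \<beta> * tilted_density p \<beta>))"
        by (rule path_growth(1)[OF p _ \<beta>]) (rule second)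
      moreover have "mean_growth M X b \<alpha> \<longlonglongrightarrow> exp (log_mgf CARD('d) p \<beta> - \<beta> * tilted_density p \<beta>)"
        by (rule path_growth(2)[OF p _ \<beta>]) (rule second)
      ultimately show ?thesis using exp_gt_zero by blast
    qed
    have phi: "convergent (mean_growth M X b \<alpha>) \<and> lambda_eq M X b \<alpha> (phi M X b \<alpha>)" if \<alpha>: "\<alpha> < \<alpha>0" for \<alpha>
    proof -
      obtain c where c: "lambda_eq M X b \<alpha> c" "mean_growth M X b \<alpha> \<longlonglongrightarrow> c" using growth[OF \<alpha>] by blast
      then have "phi M X b \<alpha> = c" unfolding phi_def by (intro limI)
      then show ?thesis using c convergentI by blast
    qed
    obtain m where m: "M_eq M X b m" using M_eq_exists by blast
    have "\<alpha>0 \<le> m"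
    proof (rule dense_le_bounded[OF \<alpha>0])
      fix \<alpha> assume "\<alpha> < \<alpha>0"
      then show "\<alpha> \<le> m" using growth density_le_max_density_limit[OF m] by blast
    qed
    with m phi show ?thesis by blast
  qed
  show ?thesis using \<alpha>0 main by blast
qed

end
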